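(* Let $(M,\omega)$ be a symplectic manifold with a star product $*$ on $C^\infty(M)((\hbar^{\mathbb{Q}}))$, let $\rho:C^{\infty}(M)((\hbar^{\mathbb{Q}}))\to\mathbb{C}((\hbar^{\mathbb{Q}}))$ be a state, let $X_1,\dots,X_n\in C^{\infty}(M)((\hbar^{\mathbb{Q}}))$ satisfy $\overline{X_j}=X_j$, put $\delta X_j:=X_j-\rho(X_j)$ and $a_{jk}:=\frac12\rho(\delta X_j*\delta X_k+\delta X_k*\delta X_j)$, $j,k=1,\dots,n$. Then $\det(a_{jk})=0$ if and only if there exist $x_1,\dots,x_n\in\mathbb{R}((\hbar^{\mathbb{Q}}))$ such that $\sum_{j=1}^n|x_j|>0$ and $$\rho\Big(\sum_{j=1}^n x_j\,\delta X_j*\sum_{k=1}^n x_k\,\delta X_k\Big)=0,$$ i.e., $\sum_{j=1}^n x_j\,\delta X_j$ is an element of the Gel'fand ideal $\mathcal{J}_\rho$ of $\rho$.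
   Context: For a field $\mathbb{K}$, $\mathbb{K}((\hbar^{\mathbb{Q}}))$ is the field of formal series $a=\sum_{q\in\mathbb{Q}}a_q\hbar^q$, $a_q\in\mathbb{K}$, whose support $\{q:a_q\neq0\}$ is well-ordered (every nonempty subset has a least element), with the usual addition and product. $\mathbb{R}((\hbar^{\mathbb{Q}}))$ is ordered by: $a>0$ iff $a\ne 0$ and $a_{q_0}>0$, where $q_0=\min\operatorname{supp}a$; $|a|=a$ if $a>0$ and $|a|=-a$ if $a\le0$. $\mathbb{C}((\hbar^{\mathbb{Q}}))=\mathbb{R}((\hbar^{\mathbb{Q}}))+i\,\mathbb{R}((\hbar^{\mathbb{Q}}))$. $C^\infty(M)((\hbar^{\mathbb{Q}}))$ is the $\mathbb{C}((\hbar^{\mathbb{Q}}))$-vector space of such series with coefficients in the complex-valued smooth functions on $M$. The overbar denotes coefficientwise complex conjugation ($\hbar$ is real). A star product is an associative $\mathbb{C}((\hbar^{\mathbb{Q}}))$-bilinear product of the form $f*g=\sum_{k=0}^\infty C_k(f,g)\hbar^k$, where the $C_k$ are bidifferential operators (acting coefficientwise) mapping $C^\infty(M)\times C^\infty(M)$ to $C^\infty(M)$, with $C_0(f,g)=fg$, $C_k(1,f)=C_k(f,1)=0$ for $k\ge1$, and $C_1(f,g)-C_1(g,f)=i\{f,g\}$, where $\{\cdot,\cdot\}$ is the Poisson bracket of $(M,\omega)$. A $\mathbb{C}((\hbar^{\mathbb{Q}}))$-linear functional $\rho:C^\infty(M)((\hbar^{\mathbb{Q}}))\to\mathbb{C}((\hbar^{\mathbb{Q}}))$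 is positive if $\rho(\overline f*f)\ge0$ (in particular lies in $\mathbb{R}((\hbar^{\mathbb{Q}}))$) for all $f$; it is a state if moreover $\rho(1)=1$. The Gel'fand ideal of $\rho$ is $\mathcal{J}_\rho:=\{f\in C^\infty(M)((\hbar^{\mathbb{Q}})):\rho(\overline f*f)=0\}$. *)

theory Defs
  imports "HOL-Analysis.Analysis" "HOL-Library.Function_Algebras"
begin

section \<open>Formal series with well-ordered rational exponents\<close>

definition well_ordered :: "'a::linorder set \<Rightarrow> bool" where
  "well_ordered S \<longleftrightarrow> (\<forall>T. T \<subseteq> S \<and> T \<noteq> {} \<longrightarrow> (\<exists>m\<in>T. \<forall>t\<in>T. m \<le> t))"

lemma well_orderedD: "well_ordered S \<Longrightarrow> T \<subseteq> S \<Longrightarrow> T \<noteq> {} \<Longrightarrow> \<exists>m\<in>T. \<forall>t\<in>T. m \<le> t"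
  by (simp add: well_ordered_def)

lemma well_ordered_subset: "well_ordered S \<Longrightarrow> T \<subseteq> S \<Longrightarrow> well_ordered T"
  by (meson order.trans well_ordered_def)

lemma well_ordered_Un:
  assumes "well_ordered A" "well_ordered B"
  shows "well_ordered (A \<union> B)"
  unfolding well_ordered_def
proof (intro allI impI, elim conjE)
  fix T assume T: "T \<subseteq> A \<union> B" "T \<noteq> {}"
  show "\<exists>m\<in>T. \<forall>t\<in>T. m \<le> t"
  proof (cases "T \<inter> A = {} \<or> T \<inter> B = {}")
    case True
    then have "T \<subseteq> A \<or> T \<subseteq> B" using T by blast
    then show ?thesis using assms T by (auto dest: well_orderedD)
  next
    case False
    obtain m where m: "m \<in> T \<inter> A" "\<forall>t\<in>T \<inter> A. m \<le> t"
      using well_orderedD[OF assms(1), of "T \<inter> A"] False by auto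
    obtain n where n: "n \<in> T \<inter> B" "\<forall>t\<in>T \<inter> B. n \<le> t"
      using well_orderedD[OF assms(2), of "T \<inter> B"] False by auto
    have "min m n \<in> T" using m n by (simp add: min_def)
    moreover have "\<forall>t\<in>T. min m n \<le> t" using m n T by (auto simp: min_le_iff_disj)
    ultimately show ?thesis by blast
  qed
qed

lemma well_ordered_finite: "finite A \<Longrightarrow> well_ordered A"
  unfolding well_ordered_def
  by (metis Min_in Min_le finite_subset)

lemma well_ordered_subseq:
  assumes "well_ordered S" "\<And>n::nat. s n \<in> S"
  shows "\<exists>f::nat\<Rightarrow>nat. strict_mono f \<and> incseq (\<lambda>n. s (f n))"
proof -
  obtain f :: "nat \<Rightarrow> nat" where f: "strict_mono f" "monoseq (\<lambda>n. s (f n))"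
    using seq_monosub by blast
  show ?thesis
  proof (cases "incseq (\<lambda>n. s (f n))")
    case True
    then show ?thesis using f by blast
  next
    case False
    then have d: "decseq (\<lambda>n. s (f n))" using f by (auto simp: monoseq_iff)
    obtain N where N: "\<forall>n. s (f N) \<le> s (f n)"
      using well_orderedD[OF assms(1), of "range (\<lambda>n. s (f n))"] assms(2) by auto
    have eq: "s (f (N + n)) = s (f N)" for n
      using N d by (simp add: decseq_def order_antisym)
    have "strict_mono (\<lambda>n. f (N + n))"
      using f(1) by (simp add: strict_mono_def)
    moreover have "incseq (\<lambda>n. s (f (N + n)))" by (simp add: eq incseq_def)
    ultimately show ?thesis by (intro exI[of _ "\<lambda>n. f (N + n)"]) simp
  qed
qed

lemma well_ordered_plus:
  fixes A B :: "rat set"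
  assumes "well_ordered A" "well_ordered B"
  shows "well_ordered {p + q |p q. p \<in> A \<and> q \<in> B}"
  unfolding well_ordered_def
proof (intro allI impI, elim conjE, rule ccontr)
  fix T assume T: "T \<subseteq> {p + q |p q. p \<in> A \<and> q \<in> B}" "T \<noteq> {}"
    and "\<not> (\<exists>m\<in>T. \<forall>t\<in>T. m \<le> t)"
  then have ex: "\<forall>m\<in>T. \<exists>t\<in>T. t < m" by (meson not_le)
  obtain t0 where t0: "t0 \<in> T" using T by blast
  have "\<exists>s. \<forall>n::nat. s n \<in> T \<and> s (Suc n) < s n"
    using dependent_nat_choice[of "\<lambda>_ x. x \<in> T" "\<lambda>_ x y. y < x"] ex t0 by blast
  then obtain s :: "nat \<Rightarrow> rat" where s: "\<And>n. s n \<in> T" "\<And>n. s (Suc n) < s n" by blast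
  have "\<forall>n. \<exists>p q. p \<in> A \<and> q \<in> B \<and> s n = p + q" using s T by blast
  then obtain a b where ab: "\<And>n. a n \<in> A" "\<And>n. b n \<in> B" "\<And>n. s n = a n + b n"
    by metis
  obtain f where f: "strict_mono f" "incseq (\<lambda>n. a (f n))"
    using well_ordered_subseq[OF assms(1)] ab(1) by blast
  obtain g where g: "strict_mono g" "incseq (\<lambda>n. b (f (g n)))"
    using well_ordered_subseq[OF assms(2), of "\<lambda>n. b (f n)"] ab(2) by blast
  have lt: "g 0 < g 1" using g(1) by (simp add: strict_mono_def)
  then have "f (g 0) < f (g 1)" using f(1) by (simp add: strict_mono_def)
  then have "s (f (g 1)) < s (f (g 0))"
    using lift_Suc_mono_less[of "\<lambda>n. - s n"] s(2) by simp
  moreover have "a (f (g 0)) \<le> a (f (g 1))" using f(2) lt by (simp add: incseq_def)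
  moreover have "b (f (g 0)) \<le> b (f (g 1))" using g(2) by (simp add: incseq_def)
  ultimately show False using ab(3) by (metis add_mono not_le)
qed

lemma finite_antidiagonal:
  fixes A B :: "rat set"
  assumes "well_ordered A" "well_ordered B"
  shows "finite {(p, q). p \<in> A \<and> q \<in> B \<and> p + q = r}"
proof -
  let ?P = "{p \<in> A. r - p \<in> B}"
  have max: "\<exists>m\<in>T. \<forall>t\<in>T. t \<le> m" if T: "T \<subseteq> ?P" "T \<noteq> {}" for T
  proof -
    have "(\<lambda>t. r - t) ` T \<subseteq> B" using T by auto
    then show ?thesis using well_orderedD[OF assms(2), of "(\<lambda>t. r - t) ` T"] T by auto
  qed
  have min: "\<exists>m\<in>T. \<forall>t\<in>T. m \<le> t" if T: "T \<subseteq> ?P" "T \<noteq> {}" for T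
  proof -
    have "T \<subseteq> A" using T by blast
    then show ?thesis using well_orderedD[OF assms(1)] T(2) by blast
  qed
  have "finite ?P"
  proof (rule ccontr)
    assume inf: "infinite ?P"
    let ?F = "{p \<in> ?P. finite {x \<in> ?P. x \<le> p}}"
    have "?P \<noteq> {}" using inf by (metis finite.emptyI)
    then obtain m0 where m0: "m0 \<in> ?P" "\<forall>t\<in>?P. m0 \<le> t" using min[of ?P] by auto
    have "{x \<in> ?P. x \<le> m0} \<subseteq> {m0}" using m0 by (auto intro: order_antisym)
    then have "m0 \<in> ?F" using m0 by (auto intro: finite_subset)
    then obtain m where m: "m \<in> ?F" "\<forall>t\<in>?F. t \<le> m" using max[of ?F] by auto
    have "\<not> ?P \<subseteq> {x \<in> ?P. x \<le> m}" using m(1) inf finite_subset by blast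
    then have "{t \<in> ?P. m < t} \<noteq> {}" by (auto simp: not_le)
    then have "\<exists>m'\<in>{t \<in> ?P. m < t}. \<forall>t\<in>{t \<in> ?P. m < t}. m' \<le> t" by (intro min) auto
    then obtain m' where m': "m' \<in> ?P" "m < m'" "\<forall>t\<in>?P. m < t \<longrightarrow> m' \<le> t" by blast
    have "{x \<in> ?P. x \<le> m'} \<subseteq> insert m' {x \<in> ?P. x \<le> m}"
      using m'(3) by (fastforce simp: not_less)
    then have "m' \<in> ?F" using m(1) m'(1) by (auto intro: finite_subset)
    then show False using m(2) m'(2) by auto
  qed
  then have "finite ((\<lambda>p. (p, r - p)) ` ?P)" by simp
  then show ?thesis by (rule rev_finite_subset) (auto simp: image_iff)
qed

typedef (overloaded) 'a hahn = "{a :: rat \<Rightarrow> 'a::zero. well_ordered {q. a q \<noteq> 0}}"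
  morphisms coeff Abs_hahn
  by (rule exI[of _ "\<lambda>_. 0"]) (simp add: well_ordered_def)

setup_lifting type_definition_hahn

abbreviation supp :: "'a::zero hahn \<Rightarrow> rat set" where
  "supp a \<equiv> {q. coeff a q \<noteq> 0}"

lemma well_ordered_supp: "well_ordered (supp a)"
  using coeff[of a] by simp

lemma hahn_eqI: "(\<And>q. coeff a q = coeff b q) \<Longrightarrow> a = b"
  by (simp add: coeff_inject[symmetric] fun_eq_iff)

lift_definition hahn_const :: "'a::zero \<Rightarrow> 'a hahn" is "\<lambda>c q. if q = 0 then c else 0"
  by (rule well_ordered_finite) (auto intro: rev_finite_subset[of "{0}"])

text \<open>Intended for maps with \<open>f 0 = 0\<close>; the case distinction keeps the support well-ordered for all others.\<close>

lift_definition hahn_map :: "('a::zero \<Rightarrow> 'b::zero) \<Rightarrow> 'a hahn \<Rightarrow> 'b hahn" is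
  "\<lambda>f a q. if a q = 0 then 0 else f (a q)"
  by (erule well_ordered_subset) auto

instantiation hahn :: (ab_group_add) ab_group_add
begin

lift_definition zero_hahn :: "'a hahn" is "\<lambda>_. 0"
  by (simp add: well_ordered_def)

lift_definition plus_hahn :: "'a hahn \<Rightarrow> 'a hahn \<Rightarrow> 'a hahn" is "\<lambda>a b q. a q + b q"
  by (rule well_ordered_subset, erule (1) well_ordered_Un) auto

lift_definition minus_hahn :: "'a hahn \<Rightarrow> 'a hahn \<Rightarrow> 'a hahn" is "\<lambda>a b q. a q - b q"
  by (rule well_ordered_subset, erule (1) well_ordered_Un) auto

lift_definition uminus_hahn :: "'a hahn \<Rightarrow> 'a hahn" is "\<lambda>a q. - a q"
  by simp

instance
  by standard (transfer; simp add: fun_eq_iff algebra_simps)+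

end

lemma coeff_simps [simp]:
  "coeff 0 q = 0" "coeff (a + b) q = coeff a q + coeff b q"
  "coeff (a - b) q = coeff a q - coeff b q" "coeff (- a) q = - coeff a q"
  by (transfer; simp)+

lemma well_ordered_mult_supp:
  fixes A B :: "rat set"
  assumes "well_ordered A" "well_ordered B" "f {} = 0"
  shows "well_ordered {r. f {(p, q). p \<in> A \<and> q \<in> B \<and> p + q = r} \<noteq> 0}"
proof (rule well_ordered_subset[OF well_ordered_plus[OF assms(1,2)]], clarify)
  fix r assume r: "f {(p, q). p \<in> A \<and> q \<in> B \<and> p + q = r} \<noteq> 0"
  show "\<exists>p q. r = p + q \<and> p \<in> A \<and> q \<in> B"
  proof (rule ccontr)
    assume "\<not> ?thesis"
    then have e: "{(p, q). p \<in> A \<and> q \<in> B \<and> p + q = r} = {}" by auto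
    show False using r assms(3) unfolding e by simp
  qed
qed

instantiation hahn :: (comm_ring) comm_ring
begin

lift_definition times_hahn :: "'a hahn \<Rightarrow> 'a hahn \<Rightarrow> 'a hahn" is
  "\<lambda>a b r. \<Sum>(p, q)\<in>{(p, q). a p \<noteq> 0 \<and> b q \<noteq> 0 \<and> p + q = r}. a p * b q"
  subgoal for a b
    using well_ordered_mult_supp[of "{q. a q \<noteq> 0}" "{q. b q \<noteq> 0}" "sum (\<lambda>(p, q). a p * b q)"]
    by simp
  done

lemma coeff_times:
  assumes "well_ordered A" "well_ordered B" "supp a \<subseteq> A" "supp b \<subseteq> B"
  shows "coeff (a * b) r = (\<Sum>(p, q)\<in>{(p, q). p \<in> A \<and> q \<in> B \<and> p + q = r}. coeff a p * coeff b q)"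
proof -
  have "coeff (a * b) r =
      (\<Sum>(p, q)\<in>{(p, q). coeff a p \<noteq> 0 \<and> coeff b q \<noteq> 0 \<and> p + q = r}. coeff a p * coeff b q)"
    by transfer simp
  also have "\<dots> = (\<Sum>(p, q)\<in>{(p, q). p \<in> A \<and> q \<in> B \<and> p + q = r}. coeff a p * coeff b q)"
    by (rule sum.mono_neutral_left[OF finite_antidiagonal[OF assms(1,2)]]) (use assms in auto)
  finally show ?thesis .
qed

lemma supp_times: "supp (a * b) \<subseteq> {p + q |p q. p \<in> supp a \<and> q \<in> supp b}"
proof clarify
  fix r assume r: "coeff (a * b) r \<noteq> 0"
  show "\<exists>p q. r = p + q \<and> p \<in> supp a \<and> q \<in> supp b"
  proof (rule ccontr)
    assume "\<not> ?thesis"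
    then have e: "{(p, q). p \<in> supp a \<and> q \<in> supp b \<and> p + q = r} = {}" by auto
    show False
      using r coeff_times[OF well_ordered_supp well_ordered_supp order.refl order.refl, of a b r]
      unfolding e by simp
  qed
qed

instance
proof
  fix a b c :: "'a hahn"
  have wo: "well_ordered (supp a)" "well_ordered (supp b)" "well_ordered (supp c)"
    by (rule well_ordered_supp)+
  show "a * b = b * a"
  proof (rule hahn_eqI)
    fix r
    show "coeff (a * b) r = coeff (b * a) r"
      unfolding coeff_times[OF wo(1,2) order.refl order.refl]
        coeff_times[OF wo(2,1) order.refl order.refl]
      by (rule sum.reindex_bij_witness[of _ prod.swap prod.swap]) (auto simp: mult.commute)
  qed
  show "(a + b) * c = a * c + b * c"
  proof (rule hahn_eqI)
    fix r
    have w: "well_ordered (supp a \<union> supp b)" using wo by (simp add: well_ordered_Un)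
    have "supp (a + b) \<subseteq> supp a \<union> supp b" by auto
    then show "coeff ((a + b) * c) r = coeff (a * c + b * c) r"
      by (simp add: coeff_times[OF w wo(3)] sum.distrib[symmetric] case_prod_unfold
          distrib_right)
  qed
  show "a * b * c = a * (b * c)"
  proof (rule hahn_eqI)
    fix r
    let ?AB = "{p + q |p q. p \<in> supp a \<and> q \<in> supp b}"
    let ?BC = "{p + q |p q. p \<in> supp b \<and> q \<in> supp c}"
    have wAB: "well_ordered ?AB" and wBC: "well_ordered ?BC"
      using wo by (simp_all only: well_ordered_plus)
    have "coeff (a * b * c) r =
      (\<Sum>u\<in>{(s, t). s \<in> ?AB \<and> t \<in> supp c \<and> s + t = r}.
        \<Sum>v\<in>{(p, q). p \<in> supp a \<and> q \<in> supp b \<and> p + q = fst u}.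
          coeff a (fst v) * coeff b (snd v) * coeff c (snd u))"
      unfolding coeff_times[OF wAB wo(3) supp_times order.refl]
        coeff_times[OF wo(1,2) order.refl order.refl]
      by (simp add: case_prod_unfold sum_distrib_right)
    also have "\<dots> = (\<Sum>(u, v)\<in>(SIGMA u:{(s, t). s \<in> ?AB \<and> t \<in> supp c \<and> s + t = r}.
        {(p, q). p \<in> supp a \<and> q \<in> supp b \<and> p + q = fst u}).
          coeff a (fst v) * coeff b (snd v) * coeff c (snd u))"
      by (rule sum.Sigma)
        (use finite_antidiagonal[OF wAB wo(3)] finite_antidiagonal[OF wo(1,2)] in auto)
    also have "\<dots> = (\<Sum>(u, v)\<in>(SIGMA u:{(s, t). s \<in> supp a \<and> t \<in> ?BC \<and> s + t = r}.
        {(p, q). p \<in> supp b \<and> q \<in> supp c \<and> p + q = snd u}).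
          coeff a (fst u) * (coeff b (fst v) * coeff c (snd v)))"
      by (rule sum.reindex_bij_witness
          [of _ "\<lambda>(u, v). ((fst u + fst v, snd v), (fst u, fst v))"
             "\<lambda>(u, v). ((fst v, snd v + snd u), (snd v, snd u))"])
        (auto simp: algebra_simps, (metis add.commute)+)
    also have "\<dots> = (\<Sum>u\<in>{(s, t). s \<in> supp a \<and> t \<in> ?BC \<and> s + t = r}.
        \<Sum>v\<in>{(p, q). p \<in> supp b \<and> q \<in> supp c \<and> p + q = snd u}.
          coeff a (fst u) * (coeff b (fst v) * coeff c (snd v)))"
      by (rule sum.Sigma[symmetric])
        (use finite_antidiagonal[OF wo(1) wBC] finite_antidiagonal[OF wo(2,3)] in auto)
    also have "\<dots> = coeff (a * (b * c)) r"
      unfolding coeff_times[OF wo(1) wBC order.refl supp_times]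
        coeff_times[OF wo(2,3) order.refl order.refl]
      by (simp add: case_prod_unfold sum_distrib_left)
    finally show "coeff (a * b * c) r = coeff (a * (b * c)) r" .
  qed
qed

end

lemma coeff_const: "coeff (hahn_const c) q = (if q = 0 then c else 0)"
  by transfer simp

lemma coeff_const_times: "coeff (hahn_const c * a) r = c * coeff a r"
  for a :: "'a::comm_ring hahn"
proof -
  have w: "well_ordered ({0} :: rat set)" by (simp add: well_ordered_finite)
  have "{(p, q). p \<in> {0} \<and> q \<in> insert r (supp a) \<and> p + q = r} = {(0, r)}" by auto
  moreover have "supp (hahn_const c) \<subseteq> {0}" by (auto simp: coeff_const)
  moreover have "well_ordered (insert r (supp a))"
    using well_ordered_Un[OF well_ordered_finite[of "{r}"] well_ordered_supp] by simp
  ultimately show ?thesis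
    using coeff_times[OF w, of "insert r (supp a)" "hahn_const c" a r]
    by (auto simp: coeff_const)
qed

instantiation hahn :: (comm_ring_1) comm_ring_1
begin

definition one_hahn :: "'a hahn" where "one_hahn = hahn_const 1"

instance
proof
  fix a :: "'a hahn"
  show "1 * a = a" by (rule hahn_eqI) (simp add: one_hahn_def coeff_const_times)
  have "coeff (0::'a hahn) 0 \<noteq> coeff 1 0" by (simp add: one_hahn_def coeff_const)
  then show "(0::'a hahn) \<noteq> 1" by metis
qed

end

lemma coeff_one: "coeff 1 q = (if q = 0 then 1 else 0)"
  by (simp add: one_hahn_def coeff_const)

definition hahn_val :: "'a::zero hahn \<Rightarrow> rat" where
  "hahn_val a = (LEAST q. coeff a q \<noteq> 0)"

lemma hahn_val:
  assumes "a \<noteq> 0"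
  shows "coeff a (hahn_val a) \<noteq> 0" "coeff a q \<noteq> 0 \<Longrightarrow> hahn_val a \<le> q"
proof -
  have "supp a \<noteq> {}" using assms hahn_eqI[of a 0] by auto
  then obtain m where m: "coeff a m \<noteq> 0" "\<forall>t. coeff a t \<noteq> 0 \<longrightarrow> m \<le> t"
    using well_orderedD[OF well_ordered_supp[of a] order.refl] by auto
  have "hahn_val a = m" unfolding hahn_val_def by (rule Least_equality) (use m in auto)
  then show "coeff a (hahn_val a) \<noteq> 0" "coeff a q \<noteq> 0 \<Longrightarrow> hahn_val a \<le> q" using m by auto
qed

lemma hahn_val_eqI: "coeff a m \<noteq> 0 \<Longrightarrow> (\<And>q. coeff a q \<noteq> 0 \<Longrightarrow> m \<le> q) \<Longrightarrow> hahn_val a = m"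
  unfolding hahn_val_def by (rule Least_equality) auto

lemma coeff_times_val:
  fixes a b :: "'a::comm_ring hahn"
  assumes "a \<noteq> 0" "b \<noteq> 0"
  shows "coeff (a * b) (hahn_val a + hahn_val b) = coeff a (hahn_val a) * coeff b (hahn_val b)"
    "r < hahn_val a + hahn_val b \<Longrightarrow> coeff (a * b) r = 0"
proof -
  have "{(p, q). p \<in> supp a \<and> q \<in> supp b \<and> p + q = hahn_val a + hahn_val b}
      = {(hahn_val a, hahn_val b)}"
  proof safe
    fix p q assume *: "coeff a p \<noteq> 0" "coeff b q \<noteq> 0" "p + q = hahn_val a + hahn_val b"
    have "hahn_val a \<le> p" "hahn_val b \<le> q" using * assms hahn_val(2) by auto
    then show "p = hahn_val a" "q = hahn_val b" using *(3) by linarith+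
  qed (use assms hahn_val in auto)
  then show "coeff (a * b) (hahn_val a + hahn_val b) = coeff a (hahn_val a) * coeff b (hahn_val b)"
    using coeff_times[OF well_ordered_supp well_ordered_supp order.refl order.refl, of a b]
    by simp
  show "coeff (a * b) r = 0" if "r < hahn_val a + hahn_val b"
  proof (rule ccontr)
    assume "coeff (a * b) r \<noteq> 0"
    then obtain p q where "r = p + q" "coeff a p \<noteq> 0" "coeff b q \<noteq> 0"
      using supp_times[of a b] by auto
    then have "hahn_val a \<le> p" "hahn_val b \<le> q" "r = p + q"
      using assms hahn_val(2) by auto
    then show False using that by linarith
  qed
qed

instance hahn :: (idom) idom
proof
  fix a b :: "'a hahn"
  assume ab: "a \<noteq> 0" "b \<noteq> 0"
  then have "coeff (a * b) (hahn_val a + hahn_val b) \<noteq> 0"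
    using hahn_val(1)[OF ab(1)] hahn_val(1)[OF ab(2)] by (simp add: coeff_times_val)
  then show "a * b \<noteq> 0" by auto
qed

lift_definition hbar_powr :: "rat \<Rightarrow> 'a::zero_neq_one hahn" is "\<lambda>s q. if q = s then 1 else 0"
  by (rule well_ordered_finite) simp

lemma coeff_hbar_powr: "coeff (hbar_powr s) q = (if q = s then 1 else 0)"
  by transfer simp

lemma hbar_powr_add: "hbar_powr s * hbar_powr t = (hbar_powr (s + t) :: 'a::comm_ring_1 hahn)"
proof (rule hahn_eqI)
  fix r
  have w: "well_ordered {s}" "well_ordered {t}" by (simp_all add: well_ordered_finite)
  have "supp (hbar_powr s :: 'a hahn) \<subseteq> {s}" "supp (hbar_powr t :: 'a hahn) \<subseteq> {t}"
    by (auto simp: coeff_hbar_powr)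
  note c = coeff_times[OF w this, of r]
  have "{(p, q). p \<in> {s} \<and> q \<in> {t} \<and> p + q = r} = (if r = s + t then {(s, t)} else {})"
    by auto
  then show "coeff (hbar_powr s * hbar_powr t :: 'a hahn) r = coeff (hbar_powr (s + t)) r"
    unfolding c by (simp add: coeff_hbar_powr)
qed

lemma hbar_powr_0: "hbar_powr 0 = (1 :: 'a::comm_ring_1 hahn)"
  by (rule hahn_eqI) (simp add: coeff_hbar_powr coeff_one)

lemma geometric_inverse:
  fixes u :: "'a::idom hahn"
  assumes pos: "\<And>q. coeff u q \<noteq> 0 \<Longrightarrow> 0 < q"
  shows "\<exists>g. (1 - u) * g = 1"
proof (cases "u = 0")
  case True
  then show ?thesis by (intro exI[of _ 1]) simp
next
  case False
  define s where "s = hahn_val u"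
  have s: "0 < s" using pos hahn_val(1)[OF False] by (simp add: s_def)
  have su: "s \<le> q" if "coeff u q \<noteq> 0" for q using hahn_val(2)[OF False that] by (simp add: s_def)
  have pw: "of_nat n * s \<le> r" if "coeff (u ^ n) r \<noteq> 0" for n r
    using that
  proof (induction n arbitrary: r)
    case 0
    then show ?case by (auto simp: coeff_one split: if_splits)
  next
    case (Suc n)
    then obtain p q where "r = p + q" "coeff u p \<noteq> 0" "coeff (u ^ n) q \<noteq> 0"
      using supp_times[of u "u ^ n"] by auto
    then have "s \<le> p" "of_nat n * s \<le> q" "r = p + q" using Suc.IH su by auto
    then show ?case by (simp add: algebra_simps)
  qed
  define N where "N r = nat \<lceil>r / s\<rceil>" for r
  have N: "coeff (u ^ n) r = 0" if "n > N r" for n r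
  proof (rule ccontr)
    assume "coeff (u ^ n) r \<noteq> 0"
    then have "of_nat n \<le> r / s" using pw s by (simp add: pos_le_divide_eq)
    then have "of_nat n \<le> (of_int \<lceil>r / s\<rceil> :: rat)" using le_of_int_ceiling order_trans by blast
    then have "int n \<le> \<lceil>r / s\<rceil>" by (metis of_int_le_iff of_int_of_nat_eq)
    then show False using that by (simp add: N_def)
  qed
  define P where "P n = (\<Sum>i\<le>n. u ^ i)" for n
  have coeff_sum: "coeff (\<Sum>i\<le>n. u ^ i) r = (\<Sum>i\<le>n. coeff (u ^ i) r)" for n r
    by (induction n) auto
  have Nmono: "N r \<le> N t" if "r \<le> t" for r t
    using that s unfolding N_def by (intro nat_mono ceiling_mono) (simp add: divide_right_mono)
  have PN: "coeff (P n) r = coeff (P (N r)) r" if "n \<ge> N r" for n r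
    unfolding P_def coeff_sum
    by (rule sum.mono_neutral_right) (use that N in auto)
  define G where "G r = coeff (P (N r)) r" for r
  have wG: "well_ordered {r. G r \<noteq> 0}"
    unfolding well_ordered_def
  proof (intro allI impI, elim conjE)
    fix T assume T: "T \<subseteq> {r. G r \<noteq> 0}" "T \<noteq> {}"
    then obtain t0 where t0: "t0 \<in> T" by blast
    have "{t \<in> T. t \<le> t0} \<subseteq> supp (P (N t0))"
    proof clarify
      fix t assume "t \<in> T" "t \<le> t0" "coeff (P (N t0)) t = 0"
      then show False using T PN[of t "N t0"] Nmono[of t t0] by (auto simp: G_def)
    qed
    from well_orderedD[OF well_ordered_supp this] t0
    obtain m where m: "m \<in> T" "m \<le> t0" "\<forall>t\<in>T. t \<le> t0 \<longrightarrow> m \<le> t" by auto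
    then have "\<forall>t\<in>T. m \<le> t" by (meson linear order_trans)
    then show "\<exists>m\<in>T. \<forall>t\<in>T. m \<le> t" using m(1) by blast
  qed
  define g where "g = Abs_hahn G"
  have g: "coeff g r = G r" for r
    unfolding g_def using wG by (simp add: Abs_hahn_inverse)
  have "(1 - u) * g = 1"
  proof (rule hahn_eqI)
    fix r
    define e where "e = g - P (N r)"
    have e: "r < q" if "coeff e q \<noteq> 0" for q
    proof (rule ccontr)
      assume "\<not> r < q"
      then have "N q \<le> N r" by (intro Nmono) simp
      then show False using that PN[of q "N r"] by (simp add: e_def g G_def)
    qed
    have e0: "coeff ((1 - u) * e) r = 0"
    proof (rule ccontr)
      assume "coeff ((1 - u) * e) r \<noteq> 0"
      then obtain p q where "r = p + q" "coeff (1 - u) p \<noteq> 0" "coeff e q \<noteq> 0"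
        using supp_times[of "1 - u" e] by auto
      moreover have "0 \<le> p" if "coeff (1 - u) p \<noteq> 0"
        using that pos[of p] by (cases "p = 0") (auto simp: coeff_one)
      ultimately show False using e[of q] by fastforce
    qed
    have "(1 - u) * P n = 1 - u ^ Suc n" for n
      unfolding P_def by (rule sum_gp_basic)
    moreover have "g = P (N r) + e" by (simp add: e_def)
    ultimately have "(1 - u) * g = 1 - u ^ Suc (N r) + (1 - u) * e"
      by (simp add: distrib_left)
    then show "coeff ((1 - u) * g) r = coeff 1 r"
      using e0 N[of r "Suc (N r)"] by simp
  qed
  then show ?thesis by blast
qed

lemma hahn_inverse_exists:
  fixes a :: "'a::field hahn"
  assumes "a \<noteq> 0"
  shows "\<exists>b. b * a = 1"
proof -
  define c where "c = hahn_const (inverse (coeff a (hahn_val a))) * hbar_powr (- hahn_val a)"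
  have ne: "hbar_powr (- hahn_val a) \<noteq> (0 :: 'a hahn)"
    by (metis coeff_hbar_powr coeff_simps(1) zero_neq_one)
  have v: "hahn_val (hbar_powr s :: 'a hahn) = s" for s
    by (rule hahn_val_eqI) (auto simp: coeff_hbar_powr split: if_splits)
  define u where "u = 1 - c * a"
  have ca: "coeff (c * a) q = inverse (coeff a (hahn_val a)) * coeff (hbar_powr (- hahn_val a) * a) q" for q
    unfolding c_def by (simp only: mult.assoc coeff_const_times)
  have "0 < q" if "coeff u q \<noteq> 0" for q
  proof (rule ccontr)
    assume "\<not> 0 < q"
    then consider "q = 0" | "q < 0" by linarith
    then show False
    proof cases
      case 1
      then show ?thesis using that coeff_times_val(1)[OF ne assms] hahn_val(1)[OF assms]
        by (simp add: u_def ca v coeff_one coeff_hbar_powr)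
    next
      case 2
      then show ?thesis using that coeff_times_val(2)[OF ne assms, of q]
        by (simp add: u_def ca v coeff_one)
    qed
  qed
  then obtain g where "(1 - u) * g = 1" using geometric_inverse by blast
  then have "(g * c) * a = 1" by (simp add: u_def mult_ac)
  then show ?thesis by blast
qed

instantiation hahn :: (field) field
begin

definition inverse_hahn :: "'a hahn \<Rightarrow> 'a hahn" where
  "inverse_hahn a = (if a = 0 then 0 else (THE b. b * a = 1))"

definition divide_hahn :: "'a hahn \<Rightarrow> 'a hahn \<Rightarrow> 'a hahn" where
  "divide_hahn a b = a * inverse b"

instance
proof
  fix a b :: "'a hahn"
  show "inverse a * a = 1" if "a \<noteq> 0"
  proof -
    have "\<exists>!b. b * a = 1"
      using hahn_inverse_exists[OF that] that by (metis mult_right_cancel)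
    then show ?thesis using theI'[of "\<lambda>b. b * a = 1"] that by (simp add: inverse_hahn_def)
  qed
  show "a div b = a * inverse b" by (simp add: divide_hahn_def)
  show "inverse (0 :: 'a hahn) = 0" by (simp add: inverse_hahn_def)
qed

end

definition hahn_pos :: "'a::linordered_idom hahn \<Rightarrow> bool" where
  "hahn_pos a \<longleftrightarrow> a \<noteq> 0 \<and> 0 < coeff a (hahn_val a)"

lemma hahn_pos_iff:
  "hahn_pos a \<longleftrightarrow> (\<exists>m. 0 < coeff a m \<and> (\<forall>q<m. coeff a q = 0))"
proof
  assume "hahn_pos a"
  then show "\<exists>m. 0 < coeff a m \<and> (\<forall>q<m. coeff a q = 0)"
    unfolding hahn_pos_def using hahn_val(2)[of a] by (metis not_le)
next
  assume "\<exists>m. 0 < coeff a m \<and> (\<forall>q<m. coeff a q = 0)"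
  then obtain m where m: "0 < coeff a m" "\<forall>q<m. coeff a q = 0" by blast
  have "hahn_val a = m" by (rule hahn_val_eqI) (use m not_le in auto)
  then show "hahn_pos a" using m by (auto simp: hahn_pos_def)
qed

lemma hahn_pos_add: "hahn_pos a \<Longrightarrow> hahn_pos b \<Longrightarrow> hahn_pos (a + b)"
  unfolding hahn_pos_iff
proof (elim exE conjE)
  fix m n
  assume *: "0 < coeff a m" "\<forall>q<m. coeff a q = 0" "0 < coeff b n" "\<forall>q<n. coeff b q = 0"
  show "\<exists>m. 0 < coeff (a + b) m \<and> (\<forall>q<m. coeff (a + b) q = 0)"
    by (rule exI[of _ "min m n"], cases m n rule: linorder_cases) (use * in \<open>auto simp: min_def\<close>)
qed

lemma hahn_pos_mult: "hahn_pos a \<Longrightarrow> hahn_pos b \<Longrightarrow> hahn_pos (a * b)"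
  unfolding hahn_pos_iff[of "a * b"] using coeff_times_val[of a b] 
  by (intro exI[of _ "hahn_val a + hahn_val b"]) (simp add: hahn_pos_def)

lemma hahn_pos_cases: "a = 0 \<or> hahn_pos a \<or> hahn_pos (- a)"
proof -
  have "hahn_val (- a) = hahn_val a" by (simp add: hahn_val_def)
  then show ?thesis using hahn_val(1)[of a] by (auto simp: hahn_pos_def neq_iff)
qed

lemma hahn_pos_uminus: "hahn_pos a \<Longrightarrow> \<not> hahn_pos (- a)"
  using hahn_pos_add[of a "- a"] by (auto simp: hahn_pos_def)

instantiation hahn :: (linordered_idom) linordered_idom
begin

definition less_hahn :: "'a hahn \<Rightarrow> 'a hahn \<Rightarrow> bool" where
  "less_hahn a b \<longleftrightarrow> hahn_pos (b - a)"

definition less_eq_hahn :: "'a hahn \<Rightarrow> 'a hahn \<Rightarrow> bool" where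
  "less_eq_hahn a b \<longleftrightarrow> a = b \<or> a < b"

definition abs_hahn :: "'a hahn \<Rightarrow> 'a hahn" where
  "abs_hahn a = (if 0 < a then a else - a)"

definition sgn_hahn :: "'a hahn \<Rightarrow> 'a hahn" where
  "sgn_hahn a = (if a = 0 then 0 else if 0 < a then 1 else - 1)"

instance
proof
  fix a b c :: "'a hahn"
  have irr: "\<not> hahn_pos (0 :: 'a hahn)" by (simp add: hahn_pos_def)
  have asym: "\<not> b < a" if "a < b" for a b :: "'a hahn"
    using hahn_pos_uminus[of "b - a"] that by (simp add: less_hahn_def)
  have tr: "a < c" if "a < b" "b < c" for a b c :: "'a hahn"
    using hahn_pos_add[of "b - a" "c - b"] that by (simp add: less_hahn_def)
  show "(a < b) = (a \<le> b \<and> \<not> b \<le> a)"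
    using asym irr by (auto simp: less_eq_hahn_def less_hahn_def)
  show "a \<le> a" by (simp add: less_eq_hahn_def)
  show "a \<le> b \<Longrightarrow> b \<le> c \<Longrightarrow> a \<le> c" using tr by (auto simp: less_eq_hahn_def)
  show "a \<le> b \<Longrightarrow> b \<le> a \<Longrightarrow> a = b" using asym by (auto simp: less_eq_hahn_def)
  show "a \<le> b \<or> b \<le> a"
    using hahn_pos_cases[of "b - a"] by (auto simp: less_eq_hahn_def less_hahn_def)
  show "a \<le> b \<Longrightarrow> c + a \<le> c + b" by (auto simp: less_eq_hahn_def less_hahn_def)
  show "a < b \<Longrightarrow> 0 < c \<Longrightarrow> c * a < c * b"
    using hahn_pos_mult[of c "b - a"] by (simp add: less_hahn_def right_diff_distrib)
  show "\<bar>a\<bar> = (if a < 0 then - a else a)"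
    using asym[of a 0] hahn_pos_cases[of a] by (auto simp: abs_hahn_def less_hahn_def)
  show "sgn a = (if a = 0 then 0 else if 0 < a then 1 else - 1)" by (simp add: sgn_hahn_def)
qed

end

instance hahn :: (linordered_field) linordered_field ..

abbreviation cplx :: "real hahn \<Rightarrow> complex hahn" where
  "cplx \<equiv> hahn_map complex_of_real"


section \<open>Smooth manifolds and symplectic forms\<close>

primrec Ck_on :: "nat \<Rightarrow> 'a::real_normed_vector set \<Rightarrow> ('a \<Rightarrow> 'b::real_normed_vector) \<Rightarrow> bool" where
  "Ck_on 0 S f \<longleftrightarrow> continuous_on S f"
| "Ck_on (Suc k) S f \<longleftrightarrow>
    (\<forall>x\<in>S. f differentiable (at x)) \<and> (\<forall>v. Ck_on k S (\<lambda>x. frechet_derivative f (at x) v))"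

definition smooth_on :: "'a::real_normed_vector set \<Rightarrow> ('a \<Rightarrow> 'b::real_normed_vector) \<Rightarrow> bool" where
  "smooth_on S f \<longleftrightarrow> (\<forall>k. Ck_on k S f)"

text \<open>
  A chart is a pair of its domain and its coordinate map; the inverse of the coordinate map is
  \<open>inv_into U \<phi>\<close>. The manifold is the whole type \<open>'m\<close>. The model space \<open>'e\<close> is a normed space
  spanned by a finite set rather than a \<open>euclidean_space\<close>, because the latter class has no
  member of dimension 0.
\<close>

type_synonym ('m, 'e) chart = "'m set \<times> ('m \<Rightarrow> 'e)"

definition smooth_manifold ::
  "('m::{t2_space, second_countable_topology}, 'e::real_normed_vector) chart set \<Rightarrow> bool" where
  "smooth_manifold A \<longleftrightarrow>
    (\<exists>B::'e set. finite B \<and> span B = UNIV) \<and>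
    (\<forall>(U, \<phi>)\<in>A. open U \<and> open (\<phi> ` U) \<and> homeomorphism U (\<phi> ` U) \<phi> (inv_into U \<phi>)) \<and>
    (\<Union>(U, \<phi>)\<in>A. U) = UNIV \<and>
    (\<forall>(U, \<phi>)\<in>A. \<forall>(V, \<psi>)\<in>A. smooth_on (\<phi> ` (U \<inter> V)) (\<psi> \<circ> inv_into U \<phi>))"

definition smooth_functions ::
  "('m, 'e::real_normed_vector) chart set \<Rightarrow> ('m \<Rightarrow> 'b::real_normed_vector) set" where
  "smooth_functions A = {f. \<forall>(U, \<phi>)\<in>A. smooth_on (\<phi> ` U) (f \<circ> inv_into U \<phi>)}"

text \<open>
  Tangent vectors are derivations of the real smooth functions. They are required to vanish on
  non-smooth arguments so that a derivation is determined by its values on smooth functions.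
\<close>

type_synonym 'm derivation = "('m \<Rightarrow> real) \<Rightarrow> real"

definition tangent_space ::
  "('m, 'e::real_normed_vector) chart set \<Rightarrow> 'm \<Rightarrow> 'm derivation set" where
  "tangent_space A p = {v.
    (\<forall>f\<in>smooth_functions A. \<forall>g\<in>smooth_functions A. \<forall>a b.
      v (\<lambda>x. a * f x + b * g x) = a * v f + b * v g) \<and>
    (\<forall>f\<in>smooth_functions A. \<forall>g\<in>smooth_functions A.
      v (\<lambda>x. f x * g x) = v f * g p + f p * v g) \<and>
    (\<forall>f. f \<notin> smooth_functions A \<longrightarrow> v f = 0)}"

text \<open>The coordinate vector in direction \<open>v\<close>, based at the point with coordinates \<open>x\<close>.\<close>

definition coord_vector ::
  "('m, 'e::real_normed_vector) chart set \<Rightarrow> ('m, 'e) chart \<Rightarrow> 'e \<Rightarrow> 'e \<Rightarrow> 'm derivation" where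
  "coord_vector A = (\<lambda>(U, \<phi>) x v f.
    if f \<in> smooth_functions A then frechet_derivative (f \<circ> inv_into U \<phi>) (at x) v else 0)"

type_synonym 'm two_form = "'m \<Rightarrow> 'm derivation \<Rightarrow> 'm derivation \<Rightarrow> real"

definition form_in_chart ::
  "('m, 'e::real_normed_vector) chart set \<Rightarrow> 'm two_form \<Rightarrow> ('m, 'e) chart \<Rightarrow> 'e \<Rightarrow> 'e \<Rightarrow> 'e \<Rightarrow> real"
  where
  "form_in_chart A \<omega> c v w x =
    \<omega> (inv_into (fst c) (snd c) x) (coord_vector A c x v) (coord_vector A c x w)"

text \<open>
  The last condition is \<open>d\<omega> = 0\<close>, evaluated on constant coordinate vector fields \<open>u\<close>, \<open>v\<close>, \<open>w\<close>
  (whose Lie brackets vanish).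
\<close>

definition symplectic_form ::
  "('m, 'e::real_normed_vector) chart set \<Rightarrow> 'm two_form \<Rightarrow> bool" where
  "symplectic_form A \<omega> \<longleftrightarrow>
    (\<forall>p. \<forall>u\<in>tangent_space A p. \<forall>v\<in>tangent_space A p. \<forall>w\<in>tangent_space A p. \<forall>a b.
      \<omega> p (\<lambda>f. a * u f + b * v f) w = a * \<omega> p u w + b * \<omega> p v w) \<and>
    (\<forall>p. \<forall>u\<in>tangent_space A p. \<forall>v\<in>tangent_space A p. \<omega> p u v = - \<omega> p v u) \<and>
    (\<forall>p. \<forall>u\<in>tangent_space A p. (\<forall>v\<in>tangent_space A p. \<omega> p u v = 0) \<longrightarrow> u = (\<lambda>_. 0)) \<and>
    (\<forall>c\<in>A. \<forall>v w. smooth_on (snd c ` fst c) (form_in_chart A \<omega> c v w)) \<and>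
    (\<forall>c\<in>A. \<forall>x\<in>snd c ` fst c. \<forall>u v w.
      frechet_derivative (form_in_chart A \<omega> c v w) (at x) u +
      frechet_derivative (form_in_chart A \<omega> c w u) (at x) v +
      frechet_derivative (form_in_chart A \<omega> c u v) (at x) w = 0)"

definition symplectic_manifold ::
  "('m::{t2_space, second_countable_topology}, 'e::real_normed_vector) chart set \<Rightarrow>
    'm two_form \<Rightarrow> bool" where
  "symplectic_manifold A \<omega> \<longleftrightarrow> smooth_manifold A \<and> symplectic_form A \<omega>"

text \<open>
  Convention: \<open>\<omega>(X\<^sub>f, \<cdot>) = df\<close> and \<open>{f, g} = \<omega>(X\<^sub>f, X\<^sub>g)\<close>, so that \<open>{q, p} = 1\<close> for
  \<open>\<omega> = dq \<and> dp\<close>. The bracket does not change if the sign of \<open>X\<^sub>f\<close> is reversed.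
\<close>

definition hamiltonian_field ::
  "('m, 'e::real_normed_vector) chart set \<Rightarrow> 'm two_form \<Rightarrow> ('m \<Rightarrow> real) \<Rightarrow> 'm \<Rightarrow> 'm derivation" where
  "hamiltonian_field A \<omega> f p =
    (THE u. u \<in> tangent_space A p \<and> (\<forall>w\<in>tangent_space A p. \<omega> p u w = w f))"

definition poisson_real ::
  "('m, 'e::real_normed_vector) chart set \<Rightarrow> 'm two_form \<Rightarrow> ('m \<Rightarrow> real) \<Rightarrow> ('m \<Rightarrow> real) \<Rightarrow> 'm \<Rightarrow> real"
  where
  "poisson_real A \<omega> f g p = \<omega> p (hamiltonian_field A \<omega> f p) (hamiltonian_field A \<omega> g p)"

definition poisson_bracket ::
  "('m, 'e::real_normed_vector) chart set \<Rightarrow> 'm two_form \<Rightarrow>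
    ('m \<Rightarrow> complex) \<Rightarrow> ('m \<Rightarrow> complex) \<Rightarrow> 'm \<Rightarrow> complex" where
  "poisson_bracket A \<omega> f g p = Complex
    (poisson_real A \<omega> (Re \<circ> f) (Re \<circ> g) p - poisson_real A \<omega> (Im \<circ> f) (Im \<circ> g) p)
    (poisson_real A \<omega> (Re \<circ> f) (Im \<circ> g) p + poisson_real A \<omega> (Im \<circ> f) (Re \<circ> g) p)"


section \<open>Bidifferential operators and star products\<close>

primrec dir_deriv ::
  "'e::real_normed_vector list \<Rightarrow> ('e \<Rightarrow> 'b::real_normed_vector) \<Rightarrow> 'e \<Rightarrow> 'b" where
  "dir_deriv [] f = f"
| "dir_deriv (v # vs) f = (\<lambda>x. frechet_derivative (dir_deriv vs f) (at x) v)"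

text \<open>
  In every chart, the operator is a finite sum of terms \<open>c \<cdot> \<partial>\<^sub>v\<^sub>s f \<cdot> \<partial>\<^sub>w\<^sub>s g\<close> with a smooth
  coefficient \<open>c\<close>, where \<open>\<partial>\<^sub>v\<^sub>s\<close> is an iterated derivative in the constant directions \<open>vs\<close>. With
  the directions taken from a basis these are the usual partial derivatives. The order is
  bounded uniformly over the atlas.
\<close>

definition bidifferential ::
  "('m, 'e::real_normed_vector) chart set \<Rightarrow>
    (('m \<Rightarrow> complex) \<Rightarrow> ('m \<Rightarrow> complex) \<Rightarrow> 'm \<Rightarrow> complex) \<Rightarrow> bool" where
  "bidifferential A C \<longleftrightarrow>
    (\<forall>f\<in>smooth_functions A. \<forall>g\<in>smooth_functions A. C f g \<in> smooth_functions A) \<and>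
    (\<exists>N. \<forall>(U, \<phi>)\<in>A. \<exists>(S :: ('e list \<times> 'e list) set) c.
      finite S \<and>
      (\<forall>(vs, ws)\<in>S. length vs \<le> N \<and> length ws \<le> N \<and> smooth_on (\<phi> ` U) (c vs ws)) \<and>
      (\<forall>f\<in>smooth_functions A. \<forall>g\<in>smooth_functions A. \<forall>x\<in>\<phi> ` U.
        C f g (inv_into U \<phi> x) =
          (\<Sum>(vs, ws)\<in>S. c vs ws x * dir_deriv vs (f \<circ> inv_into U \<phi>) x
            * dir_deriv ws (g \<circ> inv_into U \<phi>) x)))"

text \<open>
  Function-valued series use the pointwise ring structure on \<open>'m \<Rightarrow> complex\<close>; in particular
  \<open>1\<close> is the constant function 1 and \<open>*\<close> is the undeformed product.
\<close>

type_synonym 'm fun_series = "('m \<Rightarrow> complex) hahn"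

definition smooth_series ::
  "('m, 'e::real_normed_vector) chart set \<Rightarrow> 'm fun_series set" where
  "smooth_series A = {f. \<forall>q. coeff f q \<in> smooth_functions A}"

definition series_scale :: "complex hahn \<Rightarrow> 'm fun_series \<Rightarrow> 'm fun_series" where
  "series_scale c f = hahn_map (\<lambda>z _. z) c * f"

definition series_cnj :: "'m fun_series \<Rightarrow> 'm fun_series" where
  "series_cnj = hahn_map (\<lambda>f p. cnj (f p))"

text \<open>
  The coefficient formula spells out \<open>f * g = \<Sum>\<^sub>k C\<^sub>k(f, g) \<hbar>\<^sup>k\<close> with \<open>C\<^sub>k\<close> acting
  coefficientwise; its index set is finite since both supports are well-ordered.
\<close>

definition star_product ::
  "('m, 'e::real_normed_vector) chart set \<Rightarrow> 'm two_form \<Rightarrow>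
    ('m fun_series \<Rightarrow> 'm fun_series \<Rightarrow> 'm fun_series) \<Rightarrow> bool" where
  "star_product A \<omega> star \<longleftrightarrow>
    (\<forall>f\<in>smooth_series A. \<forall>g\<in>smooth_series A. \<forall>h\<in>smooth_series A.
      star (star f g) h = star f (star g h)) \<and>
    (\<forall>f\<in>smooth_series A. \<forall>g\<in>smooth_series A. \<forall>h\<in>smooth_series A. \<forall>a b.
      star (series_scale a f + series_scale b g) h = series_scale a (star f h) + series_scale b (star g h) \<and>
      star h (series_scale a f + series_scale b g) = series_scale a (star h f) + series_scale b (star h g)) \<and>
    (\<exists>C :: nat \<Rightarrow> ('m \<Rightarrow> complex) \<Rightarrow> ('m \<Rightarrow> complex) \<Rightarrow> 'm \<Rightarrow> complex.
      (\<forall>k. bidifferential A (C k)) \<and>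
      (\<forall>f\<in>smooth_functions A. \<forall>g\<in>smooth_functions A. C 0 f g = (\<lambda>p. f p * g p)) \<and>
      (\<forall>k\<ge>1. \<forall>f\<in>smooth_functions A. C k (\<lambda>_. 1) f = (\<lambda>_. 0) \<and> C k f (\<lambda>_. 1) = (\<lambda>_. 0)) \<and>
      (\<forall>f\<in>smooth_functions A. \<forall>g\<in>smooth_functions A. \<forall>p.
        C 1 f g p - C 1 g f p = \<i> * poisson_bracket A \<omega> f g p) \<and>
      (\<forall>f\<in>smooth_series A. \<forall>g\<in>smooth_series A. \<forall>r.
        coeff (star f g) r =
          (\<Sum>(k, p, q)\<in>{(k, p, q). p \<in> supp f \<and> q \<in> supp g \<and> of_nat k + p + q = r}.
            C k (coeff f p) (coeff g q))))"


section \<open>States\<close>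

definition linear_functional ::
  "('m, 'e::real_normed_vector) chart set \<Rightarrow> ('m fun_series \<Rightarrow> complex hahn) \<Rightarrow> bool" where
  "linear_functional A \<rho> \<longleftrightarrow>
    (\<forall>f\<in>smooth_series A. \<forall>g\<in>smooth_series A. \<forall>a b.
      \<rho> (series_scale a f + series_scale b g) = a * \<rho> f + b * \<rho> g)"

definition positive_functional ::
  "('m, 'e::real_normed_vector) chart set \<Rightarrow> ('m fun_series \<Rightarrow> 'm fun_series \<Rightarrow> 'm fun_series) \<Rightarrow>
    ('m fun_series \<Rightarrow> complex hahn) \<Rightarrow> bool" where
  "positive_functional A star \<rho> \<longleftrightarrow>
    linear_functional A \<rho> \<and>
    (\<forall>f\<in>smooth_series A. \<exists>r\<ge>0. \<rho> (star (series_cnj f) f) = cplx r)"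

definition state ::
  "('m, 'e::real_normed_vector) chart set \<Rightarrow> ('m fun_series \<Rightarrow> 'm fun_series \<Rightarrow> 'm fun_series) \<Rightarrow>
    ('m fun_series \<Rightarrow> complex hahn) \<Rightarrow> bool" where
  "state A star \<rho> \<longleftrightarrow> positive_functional A star \<rho> \<and> \<rho> 1 = 1"

definition gelfand_ideal ::
  "('m, 'e::real_normed_vector) chart set \<Rightarrow> ('m fun_series \<Rightarrow> 'm fun_series \<Rightarrow> 'm fun_series) \<Rightarrow>
    ('m fun_series \<Rightarrow> complex hahn) \<Rightarrow> 'm fun_series set" where
  "gelfand_ideal A star \<rho> = {f \<in> smooth_series A. \<rho> (star (series_cnj f) f) = 0}"

end

theory Submission
  imports Defs
begin

text \<open>
  The matrix \<open>a\<close> is the Gram matrix of the centred observables \<open>\<delta>X j\<close> for the symmetrized form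
  \<open>(f, g) \<mapsto> \<rho>(f * g + g * f) / 2\<close>. The theorem says that a positive semidefinite real symmetric
  matrix is singular exactly if its quadratic form has a nontrivial zero. Three things have to be
  put together.

  The entries are real. Positivity makes the state real on \<open>star (series_cnj h) h\<close>; expanding this
  for \<open>h = f + g\<close> and \<open>h = f + i g\<close> shows that \<open>\<rho>(f * g)\<close> and \<open>\<rho>(g * f)\<close> are complex conjugates
  for self-conjugate \<open>f\<close> and \<open>g\<close> (\<open>rho_hermitian\<close>). With \<open>g = 1\<close>, the unit of the star product (\<open>star_one\<close>), this gives real
  expectations, so the \<open>\<delta>X j\<close> are self-conjugate; applied to the \<open>\<delta>X j\<close> themselves it shows that
  \<open>a\<close> is the image of a real symmetric matrix \<open>B\<close>, and then \<open>det a\<close> is the image of \<open>det B\<close>.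

  The quadratic form of \<open>B\<close> at \<open>x\<close> is \<open>\<rho>(Y * Y)\<close> for the self-conjugate element
  \<open>Y = \<Sum>\<^sub>j x j \<delta>X j\<close>, hence nonnegative. Self-conjugacy of \<open>Y\<close> also identifies vanishing of
  \<open>\<rho>(Y * Y)\<close> with membership in the Gel'fand ideal.

  Over an ordered field, a zero \<open>x\<close> of a positive semidefinite quadratic form satisfies \<open>B x = 0\<close>
  (\<open>isotropic_vector_in_kernel\<close>), because a form that vanishes at \<open>x\<close> with nonzero first variation
  takes negative values nearby. Nontrivial zeros of the form are therefore the same as nontrivial
  kernel vectors, which exist exactly if the determinant vanishes (\<open>psd_det_eq_0_iff\<close>).

  All expansions use bilinearity of the star product and linearity of the state. Both are available
  only for series with smooth coefficients, so these have to be closed under sums, scalar multiples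
  and star products.
\<close>

section \<open>Positive semidefinite matrices over an ordered field\<close>

lemma scalar_product_right_simps:
  "scalar_product x (y + z) = scalar_product x y + scalar_product x z"
  "scalar_product x (t *s y) = t * scalar_product x y"
  for x :: "'a::comm_ring_1^'n"
  by (simp_all add: scalar_product_def sum.distrib distrib_left sum_distrib_left mult.left_commute)

lemma scalar_product_left_simps:
  "scalar_product (x + y) z = scalar_product x z + scalar_product y z"
  "scalar_product (t *s x) z = t * scalar_product x z"
  for x :: "'a::comm_ring_1^'n"
  by (simp_all add: scalar_product_def sum.distrib distrib_right sum_distrib_left mult.assoc)

lemma scalar_product_axis: "scalar_product (axis k 1) x = x $ k"
  for x :: "'a::comm_ring_1^'n"
  by (simp add: scalar_product_def axis_def if_distrib[of "\<lambda>u. u * _"] cong: if_cong)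

lemma scalar_product_matrix_vector:
  "scalar_product x (B *v y) = (\<Sum>j\<in>UNIV. \<Sum>k\<in>UNIV. x $ j * (y $ k * B $ j $ k))"
  for B :: "'a::comm_ring_1^'n^'n"
  by (simp add: scalar_product_def matrix_vector_mult_def sum_distrib_left mult.commute)

lemma scalar_product_symmetric_matrix:
  fixes B :: "'a::comm_ring_1^'n^'n"
  assumes "transpose B = B"
  shows "scalar_product x (B *v y) = scalar_product y (B *v x)"
proof -
  have "B $ j $ k = B $ k $ j" for j k
    using assms by (metis transpose_def vec_lambda_beta)
  then show ?thesis
    unfolding scalar_product_matrix_vector
    by (subst sum.swap) (simp add: mult.left_commute)
qed

text \<open>
  If some entry \<open>c\<close> of \<open>B x\<close> were nonzero, moving from the isotropic vector \<open>x\<close> along the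
  corresponding axis would change the form by \<open>2 t c + t\<^sup>2 d\<close>. The linear term dominates for
  small \<open>t\<close>, so a suitable sign of \<open>t\<close> makes the form negative. Unlike a diagonalisation by
  orthogonal matrices, this uses only the field operations and the order.
\<close>

lemma isotropic_vector_in_kernel:
  fixes B :: "'a::linordered_field^'n^'n"
  assumes sym: "transpose B = B"
    and psd: "\<And>x. 0 \<le> scalar_product x (B *v x)"
    and x: "scalar_product x (B *v x) = 0"
  shows "B *v x = 0"
proof (rule ccontr)
  assume "B *v x \<noteq> 0"
  then obtain k where k: "(B *v x) $ k \<noteq> 0" by (auto simp: vec_eq_iff)
  define c where "c = (B *v x) $ k"
  define d where "d = scalar_product (axis k 1) (B *v axis k 1)"
  \<comment> \<open>The minimum is at \<open>- c / d\<close>; adding 1 covers the case \<open>d = 0\<close> as well.\<close>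
  define t where "t = - (c / (d + 1))"
  have d: "d \<ge> 0" unfolding d_def by (rule psd)
  have c: "c = - (t * (d + 1))" using d by (simp add: t_def)
  let ?e = "axis k 1 :: 'a^'n"
  have ex: "scalar_product ?e (B *v x) = c" by (simp add: c_def scalar_product_axis)
  have xe: "scalar_product x (B *v ?e) = c"
    using scalar_product_symmetric_matrix[OF sym] ex by metis
  have "scalar_product (x + t *s ?e) (B *v (x + t *s ?e)) = 2 * t * c + t * t * d"
    by (simp add: matrix_vector_right_distrib vector_scalar_commute scalar_product_right_simps
        scalar_product_left_simps x ex xe flip: d_def) (simp add: algebra_simps)
  also have "\<dots> = - (t * t * (d + 2))"
    unfolding c by (simp add: algebra_simps)
  also have "\<dots> < 0"
  proof -
    have "t \<noteq> 0" using k d by (simp add: t_def c_def add_nonneg_eq_0_iff)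
    then have "0 < t * t" by (auto simp: zero_less_mult_iff neq_iff)
    then show ?thesis using d by (simp add: add_nonneg_pos)
  qed
  finally show False using psd[of "x + t *s ?e"] by simp
qed

lemma det_eq_0_iff_kernel:
  fixes B :: "'a::field^'n^'n"
  shows "det B = 0 \<longleftrightarrow> (\<exists>x. x \<noteq> 0 \<and> B *v x = 0)"
  using invertible_det_nz[of B] invertible_left_inverse[of B] matrix_left_invertible_ker[of B]
  by blast

lemma psd_det_eq_0_iff:
  fixes B :: "'a::linordered_field^'n^'n"
  assumes "transpose B = B" and "\<And>x. 0 \<le> scalar_product x (B *v x)"
  shows "det B = 0 \<longleftrightarrow> (\<exists>x. x \<noteq> 0 \<and> scalar_product x (B *v x) = 0)"
proof -
  have "B *v x = 0 \<longleftrightarrow> scalar_product x (B *v x) = 0" for x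
    using isotropic_vector_in_kernel[OF assms] by (auto simp: scalar_product_def)
  then show ?thesis unfolding det_eq_0_iff_kernel by simp
qed


section \<open>Changing coefficients along a ring homomorphism\<close>

text \<open>
  Every ring homomorphism of coefficients extends to one of series. The four instances needed are
  the inclusion of the real series, complex conjugation of scalars and of functions, and the
  embedding of scalars as constant functions, through which \<open>series_scale\<close> is multiplication in
  the undeformed ring.
\<close>

locale coeff_hom =
  fixes h :: "'a::comm_ring_1 \<Rightarrow> 'b::comm_ring_1"
  assumes add: "h (x + y) = h x + h y"
    and mult: "h (x * y) = h x * h y"
    and one: "h 1 = 1"
begin

lemma zero: "h 0 = 0"
  using add[of 0 0] by simp

lemma coeff_map: "coeff (hahn_map h a) q = h (coeff a q)"
  using zero by transfer simp

lemma map_add: "hahn_map h (a + b) = hahn_map h a + hahn_map h b"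
  by (rule hahn_eqI) (simp add: coeff_map add)

lemma map_zero: "hahn_map h 0 = 0"
  by (rule hahn_eqI) (simp add: coeff_map zero)

lemma map_one: "hahn_map h 1 = 1"
  by (rule hahn_eqI) (simp add: coeff_map zero one coeff_one)

lemma map_uminus: "hahn_map h (- a) = - hahn_map h a"
  using map_add[of a "- a"] by (simp add: map_zero eq_neg_iff_add_eq_0 add.commute)

lemma map_diff: "hahn_map h (a - b) = hahn_map h a - hahn_map h b"
  using map_add[of a "- b"] by (simp add: map_uminus)

text \<open>
  The image of a series may have smaller support, so both products are evaluated over the supports
  of the original factors, where they agree term by term.
\<close>

lemma map_mult: "hahn_map h (a * b) = hahn_map h a * hahn_map h b"
proof (rule hahn_eqI)
  fix r
  let ?I = "{(p, q). p \<in> supp a \<and> q \<in> supp b \<and> p + q = r}"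
  have supp: "supp (hahn_map h c) \<subseteq> supp c" for c
    by (auto simp: coeff_map zero)
  have "coeff (hahn_map h (a * b)) r = h (\<Sum>(p, q)\<in>?I. coeff a p * coeff b q)"
    unfolding coeff_map coeff_times[OF well_ordered_supp well_ordered_supp order.refl order.refl] ..
  also have "\<dots> = (\<Sum>(p, q)\<in>?I. h (coeff a p) * h (coeff b q))"
    using sum_comp_morphism[of h "\<lambda>(p, q). coeff a p * coeff b q" ?I]
    by (simp add: zero add mult o_def case_prod_unfold)
  also have "\<dots> = coeff (hahn_map h a * hahn_map h b) r"
    by (subst coeff_times[OF well_ordered_supp well_ordered_supp supp supp]) (simp only: coeff_map)
  finally show "coeff (hahn_map h (a * b)) r = coeff (hahn_map h a * hahn_map h b) r" .
qed

lemma map_sum: "hahn_map h (\<Sum>i\<in>I. a i) = (\<Sum>i\<in>I. hahn_map h (a i))"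
  by (induction I rule: infinite_finite_induct) (simp_all add: map_zero map_add)

lemma map_prod: "hahn_map h (\<Prod>i\<in>I. a i) = (\<Prod>i\<in>I. hahn_map h (a i))"
  by (induction I rule: infinite_finite_induct) (simp_all add: map_one map_mult)

lemma map_det:
  fixes B :: "'a hahn^'n^'n"
  shows "hahn_map h (det B) = det (\<chi> j k. hahn_map h (B $ j $ k))"
proof -
  have "hahn_map h (of_int (sign p)) = of_int (sign p)" for p :: "'n \<Rightarrow> 'n"
    by (simp add: sign_def map_one map_uminus)
  then show ?thesis by (simp add: det_def map_sum map_mult map_prod)
qed

end

abbreviation hcnj :: "complex hahn \<Rightarrow> complex hahn" where
  "hcnj \<equiv> hahn_map cnj"

interpretation cplx: coeff_hom complex_of_real
  by standard simp_all

interpretation hcnj: coeff_hom cnj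
  by standard simp_all

interpretation const_fun: coeff_hom "\<lambda>z::complex. \<lambda>_::'m. z"
  by standard (simp_all add: fun_eq_iff)

interpretation series_cnj: coeff_hom "\<lambda>f (p::'m). cnj (f p)"
  by standard (simp_all add: fun_eq_iff)

lemma cplx_eq_iff: "cplx r = cplx s \<longleftrightarrow> r = s"
  by (auto intro!: hahn_eqI dest!: arg_cong[of _ _ coeff] simp: fun_eq_iff cplx.coeff_map)

lemma cplx_eq_0_iff: "cplx r = 0 \<longleftrightarrow> r = 0"
  using cplx_eq_iff[of r 0] by (simp add: cplx.map_zero)

lemma hcnj_cplx: "hcnj (cplx r) = cplx r"
  by (rule hahn_eqI) (simp add: hcnj.coeff_map cplx.coeff_map)

lemma two_complex_hahn: "(2 :: complex hahn) \<noteq> 0"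
proof -
  have "coeff (1 + 1 :: complex hahn) 0 \<noteq> 0" by (simp only: coeff_simps) (simp add: coeff_one)
  then show ?thesis by auto
qed

lemma add_hcnj: "z + hcnj z = 2 * cplx (hahn_map Re z)"
proof (rule hahn_eqI)
  fix q
  have "coeff (hahn_map Re z) q = Re (coeff z q)" by transfer simp
  then show "coeff (z + hcnj z) q = coeff (2 * cplx (hahn_map Re z)) q"
    unfolding mult_2 coeff_simps hcnj.coeff_map cplx.coeff_map by (simp add: complex_eq_iff)
qed

text \<open>
  This is how conjugate symmetry is extracted in a polarization argument: reality of \<open>u + v\<close>
  says that the imaginary parts are opposite, reality of \<open>i(u - v)\<close> that the real parts agree.
\<close>

lemma hcnj_conjugate_pair:
  assumes "hcnj (u + v) = u + v"
    and "hcnj (hahn_const \<i> * (u - v)) = hahn_const \<i> * (u - v)"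
  shows "hcnj u = v"
proof (rule hahn_eqI)
  fix q
  have "cnj (coeff (u + v) q) = coeff (u + v) q"
    "cnj (coeff (hahn_const \<i> * (u - v)) q) = coeff (hahn_const \<i> * (u - v)) q"
    using assms by (metis hcnj.coeff_map)+
  then show "coeff (hcnj u) q = coeff v q"
    by (simp add: hcnj.coeff_map coeff_const_times complex_eq_iff)
qed

lemma hcnj_i: "hcnj (hahn_const \<i>) = - hahn_const \<i>"
  by (rule hahn_eqI) (simp add: hcnj.coeff_map coeff_const)

lemma hahn_i_squared: "hahn_const \<i> * hahn_const \<i> = - 1"
  by (rule hahn_eqI) (simp add: coeff_const_times coeff_const coeff_one)


section \<open>Series with smooth coefficients\<close>

lemma series_scale_simps [simp]:
  "series_scale 1 f = f" "series_scale 0 f = 0" "series_scale a 0 = 0"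
  "series_scale (- a) f = - series_scale a f"
  by (simp_all add: series_scale_def const_fun.map_one const_fun.map_zero const_fun.map_uminus)

lemma series_cnj_add: "series_cnj (f + g) = series_cnj f + series_cnj g"
  by (simp add: series_cnj_def series_cnj.map_add)

lemma series_cnj_diff: "series_cnj (f - g) = series_cnj f - series_cnj g"
  by (simp add: series_cnj_def series_cnj.map_diff)

lemma series_cnj_one: "series_cnj 1 = 1"
  by (simp add: series_cnj_def series_cnj.map_one)

lemma series_cnj_sum: "series_cnj (\<Sum>i\<in>I. f i) = (\<Sum>i\<in>I. series_cnj (f i))"
  by (simp add: series_cnj_def series_cnj.map_sum)

lemma series_cnj_scale:
  fixes f :: "'m fun_series"
  shows "series_cnj (series_scale a f) = series_scale (hcnj a) (series_cnj f)"
proof -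
  have "hahn_map (\<lambda>f p. cnj (f p)) (hahn_map (\<lambda>z _::'m. z) a) = hahn_map (\<lambda>z _. z) (hcnj a)"
    by (rule hahn_eqI) (simp add: series_cnj.coeff_map const_fun.coeff_map hcnj.coeff_map)
  then show ?thesis by (simp add: series_cnj_def series_scale_def series_cnj.map_mult)
qed

text \<open>
  The recursion for \<open>Ck_on\<close> speaks of \<open>frechet_derivative\<close> as a function on the whole space, while
  the rules of calculus hold only at the points of \<open>S\<close>. Since \<open>S\<close> is open, \<open>Ck_on\<close> depends only
  on the restriction to \<open>S\<close>, and any expression for the derivative there may be used instead.
\<close>

lemma Ck_on_SucD:
  assumes "Ck_on (Suc k) S f"
  shows "x \<in> S \<Longrightarrow> (f has_derivative frechet_derivative f (at x)) (at x)"
    and "Ck_on k S (\<lambda>x. frechet_derivative f (at x) v)"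
  using assms by (simp_all flip: frechet_derivative_works)

lemma Ck_on_cong:
  assumes "open S" "\<And>x. x \<in> S \<Longrightarrow> f x = g x" "Ck_on k S f"
  shows "Ck_on k S g"
  using assms(2,3)
proof (induction k arbitrary: f g)
  case 0
  then show ?case using continuous_on_cong[of S S f g] by simp
next
  case (Suc k)
  note f = Ck_on_SucD[OF Suc.prems(2)]
  have g: "(g has_derivative frechet_derivative f (at x)) (at x)" if "x \<in> S" for x
    by (rule has_derivative_transform_within_open[OF f(1)[OF that] assms(1) that Suc.prems(1)])
  have "Ck_on k S (\<lambda>x. frechet_derivative g (at x) v)" for v
  proof (rule Suc.IH[OF _ f(2)])
    fix x assume "x \<in> S"
    show "frechet_derivative f (at x) v = frechet_derivative g (at x) v"
      by (simp only: frechet_derivative_at[OF g[OF \<open>x \<in> S\<close>]])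
  qed
  then show ?case using g by (auto simp: differentiable_def)
qed

lemma Ck_on_const: "Ck_on k S (\<lambda>_. c)"
  by (induction k arbitrary: c) simp_all

lemma Ck_on_SucI:
  assumes "open S"
    and D: "\<And>x. x \<in> S \<Longrightarrow> (f has_derivative D x) (at x)"
    and "\<And>v. Ck_on k S (\<lambda>x. D x v)"
  shows "Ck_on (Suc k) S f"
proof -
  have "Ck_on k S (\<lambda>x. frechet_derivative f (at x) v)" for v
  proof (rule Ck_on_cong[OF assms(1) _ assms(3)])
    fix x assume "x \<in> S"
    show "D x v = frechet_derivative f (at x) v"
      by (simp only: frechet_derivative_at[OF D[OF \<open>x \<in> S\<close>]])
  qed
  then show ?thesis using D by (auto simp: differentiable_def)
qed

lemma Ck_on_add:
  assumes "open S" "Ck_on k S f" "Ck_on k S g"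
  shows "Ck_on k S (\<lambda>x. f x + g x)"
  using assms(2,3)
proof (induction k arbitrary: f g)
  case 0
  then show ?case by (simp add: continuous_on_add)
next
  case (Suc k)
  note f = Ck_on_SucD[OF Suc.prems(1)] and g = Ck_on_SucD[OF Suc.prems(2)]
  show ?case
    by (rule Ck_on_SucI[OF assms(1) has_derivative_add[OF f(1) g(1)] Suc.IH[OF f(2) g(2)]])
qed

lemma Ck_on_bounded_linear:
  assumes "open S" "bounded_linear h" "Ck_on k S f"
  shows "Ck_on k S (\<lambda>x. h (f x))"
  using assms(3)
proof (induction k arbitrary: f)
  case 0
  then show ?case by (simp add: bounded_linear.continuous_on[OF assms(2)])
next
  case (Suc k)
  note f = Ck_on_SucD[OF Suc.prems]
  show ?case
    by (rule Ck_on_SucI[OF assms(1) bounded_linear.has_derivative[OF assms(2) f(1)] Suc.IH[OF f(2)]])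
qed

text \<open>
  Orders of \<open>\<hbar>\<close> contributed by the operators of a star product, seen as exponents: together with
  the support of a series they have finite antidiagonals.
\<close>

lemma well_ordered_range_of_nat: "well_ordered (range (of_nat :: nat \<Rightarrow> rat))"
  unfolding well_ordered_def
proof (intro allI impI, elim conjE)
  fix T assume T: "T \<subseteq> range (of_nat :: nat \<Rightarrow> rat)" "T \<noteq> {}"
  then obtain n where "of_nat n \<in> T" by blast
  then have "of_nat (LEAST n. of_nat n \<in> T) \<in> T" by (rule LeastI)
  moreover have "of_nat (LEAST n. of_nat n \<in> T) \<le> t" if t: "t \<in> T" for t
  proof -
    obtain l where "t = of_nat l" using t T(1) by blast
    then show ?thesis using t by (simp add: Least_le)
  qed
  ultimately show "\<exists>m\<in>T. \<forall>t\<in>T. m \<le> t" by blast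
qed

locale star_algebra =
  fixes A :: "('m::{t2_space, second_countable_topology}, 'e::real_normed_vector) chart set"
    and \<omega> :: "'m two_form"
    and star :: "'m fun_series \<Rightarrow> 'm fun_series \<Rightarrow> 'm fun_series"
  assumes smooth_manifold: "smooth_manifold A"
    and star_product: "star_product A \<omega> star"
begin

lemma open_chart: "(U, \<phi>) \<in> A \<Longrightarrow> open (\<phi> ` U)"
  using smooth_manifold by (auto simp: smooth_manifold_def)

lemma smooth_functions_const: "(\<lambda>_. c) \<in> smooth_functions A"
  by (auto simp: smooth_functions_def smooth_on_def o_def Ck_on_const)

lemma smooth_functions_add:
  "f \<in> smooth_functions A \<Longrightarrow> g \<in> smooth_functions A \<Longrightarrow> f + g \<in> smooth_functions A"
  by (auto simp: smooth_functions_def smooth_on_def o_def intro!: Ck_on_add open_chart)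

lemma smooth_functions_cmult:
  "f \<in> smooth_functions A \<Longrightarrow> (\<lambda>_. c) * f \<in> smooth_functions A" for f :: "'m \<Rightarrow> complex"
  by (auto simp: smooth_functions_def smooth_on_def o_def
      intro!: Ck_on_bounded_linear[OF _ bounded_linear_mult_right] open_chart)

lemma smooth_functions_sum:
  "(\<And>i. i \<in> I \<Longrightarrow> f i \<in> smooth_functions A) \<Longrightarrow> sum f I \<in> smooth_functions A"
  for f :: "'i \<Rightarrow> 'm \<Rightarrow> complex"
  using smooth_functions_const[of "0::complex"]
  by (induction I rule: infinite_finite_induct)
     (simp_all add: smooth_functions_add zero_fun_def[symmetric])

lemma smooth_one: "1 \<in> smooth_series A"
  using smooth_functions_const[of "0::complex"] smooth_functions_const[of "1::complex"]
  by (simp add: smooth_series_def coeff_one zero_fun_def one_fun_def)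

lemma smooth_add: "f \<in> smooth_series A \<Longrightarrow> g \<in> smooth_series A \<Longrightarrow> f + g \<in> smooth_series A"
  by (simp add: smooth_series_def smooth_functions_add)

lemma smooth_scale:
  assumes "f \<in> smooth_series A"
  shows "series_scale a f \<in> smooth_series A"
  unfolding smooth_series_def mem_Collect_eq series_scale_def
    coeff_times[OF well_ordered_supp well_ordered_supp order.refl order.refl] const_fun.coeff_map
  using assms by (auto intro!: smooth_functions_sum smooth_functions_cmult simp: smooth_series_def)

lemma smooth_zero: "0 \<in> smooth_series A"
  using smooth_scale[OF smooth_one, of 0] by simp

lemma smooth_diff: "f \<in> smooth_series A \<Longrightarrow> g \<in> smooth_series A \<Longrightarrow> f - g \<in> smooth_series A"
  using smooth_add[of f "series_scale (- 1) g"] smooth_scale[of g "- 1"] by simp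

lemma smooth_sum:
  "(\<And>i. i \<in> I \<Longrightarrow> f i \<in> smooth_series A) \<Longrightarrow> sum f I \<in> smooth_series A"
  by (induction I rule: infinite_finite_induct) (simp_all add: smooth_zero smooth_add)


section \<open>Smoothness, unit and bilinearity of the star product\<close>

lemma star_linear:
  assumes "f \<in> smooth_series A" "g \<in> smooth_series A" "h \<in> smooth_series A"
  shows "star (series_scale a f + series_scale b g) h
      = series_scale a (star f h) + series_scale b (star g h)"
    and "star h (series_scale a f + series_scale b g)
      = series_scale a (star h f) + series_scale b (star h g)"
  using star_product assms unfolding star_product_def by blast+

lemma star_add:
  assumes "f \<in> smooth_series A" "g \<in> smooth_series A" "h \<in> smooth_series A"
  shows "star (f + g) h = star f h + star g h" "star h (f + g) = star h f + star h g"
  using star_linear[OF assms, of 1 1] by simp_all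

lemma star_scale:
  assumes "f \<in> smooth_series A" "h \<in> smooth_series A"
  shows "star (series_scale a f) h = series_scale a (star f h)"
    "star h (series_scale a f) = series_scale a (star h f)"
  using star_linear[OF assms(1,1,2), of a 0] by simp_all

text \<open>
  The operators \<open>C k\<close> behind the star product, with constants and products written in the ring of
  functions so that they match the coefficients of \<open>1\<close>.
\<close>

lemma star_coeffs:
  obtains C :: "nat \<Rightarrow> ('m \<Rightarrow> complex) \<Rightarrow> ('m \<Rightarrow> complex) \<Rightarrow> 'm \<Rightarrow> complex"
  where "\<And>k f g. f \<in> smooth_functions A \<Longrightarrow> g \<in> smooth_functions A \<Longrightarrow> C k f g \<in> smooth_functions A"
    and "\<And>f g. f \<in> smooth_functions A \<Longrightarrow> g \<in> smooth_functions A \<Longrightarrow> C 0 f g = f * g"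
    and "\<And>k f. k \<noteq> 0 \<Longrightarrow> f \<in> smooth_functions A \<Longrightarrow> C k 1 f = 0"
    and "\<And>k f. k \<noteq> 0 \<Longrightarrow> f \<in> smooth_functions A \<Longrightarrow> C k f 1 = 0"
    and "\<And>f g r. f \<in> smooth_series A \<Longrightarrow> g \<in> smooth_series A \<Longrightarrow> coeff (star f g) r =
      (\<Sum>(k, p, q)\<in>{(k, p, q). p \<in> supp f \<and> q \<in> supp g \<and> of_nat k + p + q = r}.
        C k (coeff f p) (coeff g q))"
proof -
  from star_product obtain C where C: "\<forall>k. bidifferential A (C k)"
      "\<forall>f\<in>smooth_functions A. \<forall>g\<in>smooth_functions A. C 0 f g = (\<lambda>p. f p * g p)"
      "\<forall>k\<ge>1. \<forall>f\<in>smooth_functions A. C k (\<lambda>_. 1) f = (\<lambda>_. 0) \<and> C k f (\<lambda>_. 1) = (\<lambda>_. 0)"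
      "\<forall>f\<in>smooth_series A. \<forall>g\<in>smooth_series A. \<forall>r. coeff (star f g) r =
      (\<Sum>(k, p, q)\<in>{(k, p, q). p \<in> supp f \<and> q \<in> supp g \<and> of_nat k + p + q = r}.
        C k (coeff f p) (coeff g q))"
    unfolding star_product_def by blast
  show ?thesis
    by (rule that[of C])
      (use C in \<open>auto simp: bidifferential_def times_fun_def one_fun_def zero_fun_def\<close>)
qed

text \<open>
  Each coefficient of a star product is a sum of smooth functions. This is what allows linearity
  of a state to be applied to star products.
\<close>

lemma smooth_star:
  assumes "f \<in> smooth_series A" "g \<in> smooth_series A"
  shows "star f g \<in> smooth_series A"
proof (rule star_coeffs)
  fix C :: "nat \<Rightarrow> ('m \<Rightarrow> complex) \<Rightarrow> ('m \<Rightarrow> complex) \<Rightarrow> 'm \<Rightarrow> complex"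
  assume C: "\<And>k f g. f \<in> smooth_functions A \<Longrightarrow> g \<in> smooth_functions A \<Longrightarrow> C k f g \<in> smooth_functions A"
    and coeff: "\<And>f g r. f \<in> smooth_series A \<Longrightarrow> g \<in> smooth_series A \<Longrightarrow> coeff (star f g) r =
      (\<Sum>(k, p, q)\<in>{(k, p, q). p \<in> supp f \<and> q \<in> supp g \<and> of_nat k + p + q = r}.
        C k (coeff f p) (coeff g q))"
  show ?thesis
    unfolding smooth_series_def mem_Collect_eq coeff[OF assms]
    using assms by (auto intro!: smooth_functions_sum C simp: smooth_series_def)
qed

text \<open>
  The series \<open>1\<close> has the single exponent 0, so only pairs \<open>(k, q)\<close> with \<open>q\<close> in the support of \<open>f\<close>
  and \<open>k + q = r\<close> contribute to the coefficient at \<open>r\<close>. The operators with \<open>k \<noteq> 0\<close> annihilate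
  constants, which leaves the undeformed product at \<open>k = 0\<close>.
\<close>

lemma star_one:
  assumes f: "f \<in> smooth_series A"
  shows "star 1 f = f" and "star f 1 = f"
proof -
  obtain C :: "nat \<Rightarrow> ('m \<Rightarrow> complex) \<Rightarrow> ('m \<Rightarrow> complex) \<Rightarrow> 'm \<Rightarrow> complex"
    where "\<And>k f g. f \<in> smooth_functions A \<Longrightarrow> g \<in> smooth_functions A \<Longrightarrow> C k f g \<in> smooth_functions A"
    and C0: "\<And>f g. f \<in> smooth_functions A \<Longrightarrow> g \<in> smooth_functions A \<Longrightarrow> C 0 f g = f * g"
    and Ck: "\<And>k f. k \<noteq> 0 \<Longrightarrow> f \<in> smooth_functions A \<Longrightarrow> C k 1 f = 0"
      "\<And>k f. k \<noteq> 0 \<Longrightarrow> f \<in> smooth_functions A \<Longrightarrow> C k f 1 = 0"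
    and coeff: "\<And>f g r. f \<in> smooth_series A \<Longrightarrow> g \<in> smooth_series A \<Longrightarrow> coeff (star f g) r =
      (\<Sum>(k, p, q)\<in>{(k, p, q). p \<in> supp f \<and> q \<in> supp g \<and> of_nat k + p + q = r}.
        C k (coeff f p) (coeff g q))"
    by (rule star_coeffs) blast
  have sf: "coeff f q \<in> smooth_functions A" for q using f by (simp add: smooth_series_def)
  have s1: "(1 :: 'm \<Rightarrow> complex) \<in> smooth_functions A" "coeff 1 0 = (1 :: 'm \<Rightarrow> complex)"
    using smooth_functions_const[of "1::complex"] by (simp_all add: one_fun_def coeff_one)
  have supp1: "p \<in> supp (1 :: 'm fun_series) \<longleftrightarrow> p = 0" for p by (simp add: coeff_one)
  \<comment> \<open>A sum over an infinite index set is 0 by convention, so finiteness is essential here.\<close>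
  have fin: "finite {(k, q). q \<in> supp f \<and> of_nat k + q = r}" for r
    by (rule inj_on_finite[OF _ _ finite_antidiagonal[OF well_ordered_range_of_nat well_ordered_supp, of f r],
          of "\<lambda>(k, q). (of_nat k, q)"]) (auto simp: inj_on_def)
  have single: "(\<Sum>(k, q)\<in>{(k, q). q \<in> supp f \<and> of_nat k + q = r}. if k = 0 then coeff f q else 0)
      = coeff f r" for r
  proof -
    have "(\<Sum>(k, q)\<in>{(k, q). q \<in> supp f \<and> of_nat k + q = r}. if k = 0 then coeff f q else 0)
      = (\<Sum>(k, q)\<in>{(k::nat, q). k = 0 \<and> q = r \<and> q \<in> supp f}. coeff f q)"
      by (rule sum.mono_neutral_cong_right[OF fin]) (auto split: if_splits)
    also have "\<dots> = (\<Sum>(k, q)\<in>(if r \<in> supp f then {(0::nat, r)} else {}). coeff f q)"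
      by (rule sum.cong) auto
    also have "\<dots> = coeff f r" by simp
    finally show ?thesis .
  qed
  show "star 1 f = f"
  proof (rule hahn_eqI)
    fix r
    have "coeff (star 1 f) r =
      (\<Sum>(k, q)\<in>{(k, q). q \<in> supp f \<and> of_nat k + q = r}. if k = 0 then coeff f q else 0)"
      unfolding coeff[OF smooth_one f] supp1
      by (rule sum.reindex_bij_witness[of _ "\<lambda>(k, q). (k, 0, q)" "\<lambda>(k, p, q). (k, q)"])
        (auto simp: s1 C0 Ck sf)
    then show "coeff (star 1 f) r = coeff f r" by (simp only: single)
  qed
  show "star f 1 = f"
  proof (rule hahn_eqI)
    fix r
    have "coeff (star f 1) r =
      (\<Sum>(k, q)\<in>{(k, q). q \<in> supp f \<and> of_nat k + q = r}. if k = 0 then coeff f q else 0)"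
      unfolding coeff[OF f smooth_one] supp1
      by (rule sum.reindex_bij_witness[of _ "\<lambda>(k, q). (k, q, 0)" "\<lambda>(k, p, q). (k, p)"])
        (auto simp: s1 C0 Ck sf)
    then show "coeff (star f 1) r = coeff f r" by (simp only: single)
  qed
qed

lemma star_sum:
  assumes "\<And>i. i \<in> I \<Longrightarrow> f i \<in> smooth_series A" "g \<in> smooth_series A"
  shows "star (\<Sum>i\<in>I. f i) g = (\<Sum>i\<in>I. star (f i) g)"
    and "star g (\<Sum>i\<in>I. f i) = (\<Sum>i\<in>I. star g (f i))"
proof -
  have z: "star 0 g = 0" "star g 0 = 0"
    using star_scale[OF smooth_one assms(2), of 0] by simp_all
  show "star (\<Sum>i\<in>I. f i) g = (\<Sum>i\<in>I. star (f i) g)"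
    using assms(1) by (induction I rule: infinite_finite_induct)
      (simp_all add: z star_add smooth_sum assms(2))
  show "star g (\<Sum>i\<in>I. f i) = (\<Sum>i\<in>I. star g (f i))"
    using assms(1) by (induction I rule: infinite_finite_induct)
      (simp_all add: z star_add smooth_sum assms(2))
qed

end


section \<open>States and their covariance matrices\<close>

locale star_state = star_algebra A \<omega> star
  for A :: "('m::{t2_space, second_countable_topology}, 'e::real_normed_vector) chart set"
    and \<omega> :: "'m two_form"
    and star :: "'m fun_series \<Rightarrow> 'm fun_series \<Rightarrow> 'm fun_series" +
  fixes \<rho> :: "'m fun_series \<Rightarrow> complex hahn"
  assumes state: "state A star \<rho>"
begin

lemma rho_linear:
  "f \<in> smooth_series A \<Longrightarrow> g \<in> smooth_series A \<Longrightarrow>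
    \<rho> (series_scale a f + series_scale b g) = a * \<rho> f + b * \<rho> g"
  using state by (simp add: state_def positive_functional_def linear_functional_def)

lemma rho_add: "f \<in> smooth_series A \<Longrightarrow> g \<in> smooth_series A \<Longrightarrow> \<rho> (f + g) = \<rho> f + \<rho> g"
  using rho_linear[of f g 1 1] by simp

lemma rho_scale: "f \<in> smooth_series A \<Longrightarrow> \<rho> (series_scale a f) = a * \<rho> f"
  using rho_linear[of f f a 0] by simp

lemma rho_sum:
  "(\<And>i. i \<in> I \<Longrightarrow> f i \<in> smooth_series A) \<Longrightarrow> \<rho> (\<Sum>i\<in>I. f i) = (\<Sum>i\<in>I. \<rho> (f i))"
  using rho_scale[OF smooth_one, of 0]
  by (induction I rule: infinite_finite_induct) (simp_all add: rho_add smooth_sum)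

lemma rho_positive:
  assumes "f \<in> smooth_series A"
  obtains r where "r \<ge> 0" "\<rho> (star (series_cnj f) f) = cplx r"
  using state assms unfolding state_def positive_functional_def by blast

lemma rho_real: "f \<in> smooth_series A \<Longrightarrow>
    hcnj (\<rho> (star (series_cnj f) f)) = \<rho> (star (series_cnj f) f)"
  using rho_positive hcnj_cplx by metis

text \<open>
  Polarization: by positivity the state is real on \<open>star (series_cnj h) h\<close> for \<open>h\<close> equal to \<open>f\<close>,
  \<open>g\<close>, \<open>f + g\<close> and \<open>f + i g\<close>. Subtracting the first two values from the others leaves the real
  quantities \<open>\<rho>(f * g) + \<rho>(g * f)\<close> and \<open>i (\<rho>(f * g) - \<rho>(g * f))\<close>.
\<close>

lemma rho_hermitian:
  assumes f: "f \<in> smooth_series A" "series_cnj f = f"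
    and g: "g \<in> smooth_series A" "series_cnj g = g"
  shows "hcnj (\<rho> (star f g)) = \<rho> (star g f)"
proof -
  let ?i = "hahn_const \<i>"
  note smooth = f(1) g(1) smooth_add smooth_scale smooth_star
  have expand: "\<rho> (star (f + series_scale b g) (f + series_scale c g)) =
      \<rho> (star f f) + c * \<rho> (star f g) + b * \<rho> (star g f) + b * c * \<rho> (star g g)" for b c
    by (simp add: star_add star_scale rho_add rho_scale smooth algebra_simps)
  have diag: "hcnj (\<rho> (star f f)) = \<rho> (star f f)" "hcnj (\<rho> (star g g)) = \<rho> (star g g)"
    using rho_real[OF f(1)] rho_real[OF g(1)] f(2) g(2) by simp_all
  have "\<rho> (star (f + g) (f + g)) =
      \<rho> (star f f) + (\<rho> (star f g) + \<rho> (star g f)) + \<rho> (star g g)"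
    using expand[of 1 1] by simp
  moreover have "series_cnj (f + g) = f + g"
    by (simp add: series_cnj_add f g)
  ultimately have 1: "hcnj (\<rho> (star f g) + \<rho> (star g f)) = \<rho> (star f g) + \<rho> (star g f)"
    using rho_real[of "f + g"] by (simp add: smooth diag hcnj.map_add)
  have "\<rho> (star (f + series_scale (- ?i) g) (f + series_scale ?i g)) =
      \<rho> (star f f) + ?i * (\<rho> (star f g) - \<rho> (star g f)) + \<rho> (star g g)"
    unfolding expand by (simp add: hahn_i_squared algebra_simps)
  moreover have "series_cnj (f + series_scale ?i g) = f + series_scale (- ?i) g"
    by (simp add: series_cnj_add series_cnj_scale hcnj_i f g)
  ultimately have 2: "hcnj (?i * (\<rho> (star f g) - \<rho> (star g f)))
      = ?i * (\<rho> (star f g) - \<rho> (star g f))"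
    using rho_real[of "f + series_scale ?i g"]
    by (simp add: smooth diag hcnj.map_add)
  show ?thesis by (rule hcnj_conjugate_pair[OF 1 2])
qed

text \<open>
  The case \<open>g = 1\<close>. It makes the expectations \<open>\<rho>(X)\<close> real, so that the centred observables
  \<open>X - \<rho>(X)\<close> remain self-conjugate.
\<close>

lemma rho_self_conjugate:
  assumes "f \<in> smooth_series A" "series_cnj f = f"
  shows "hcnj (\<rho> f) = \<rho> f"
  using rho_hermitian[OF assms smooth_one series_cnj_one] by (simp add: star_one assms)

end

theorem proposition6p1:
  fixes A :: "('m::{t2_space, second_countable_topology}, 'e::real_normed_vector) chart set"
    and \<omega> :: "'m two_form"
    and star :: "'m fun_series \<Rightarrow> 'm fun_series \<Rightarrow> 'm fun_series"
    and \<rho> :: "'m fun_series \<Rightarrow> complex hahn"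
    and X \<delta>X :: "'n::finite \<Rightarrow> 'm fun_series"
    and a :: "'n \<Rightarrow> 'n \<Rightarrow> complex hahn"
  assumes "symplectic_manifold A \<omega>"
    and "star_product A \<omega> star"
    and "state A star \<rho>"
    and "\<And>j. X j \<in> smooth_series A"
    and "\<And>j. series_cnj (X j) = X j"
    and \<delta>X: "\<And>j. \<delta>X j = X j - series_scale (\<rho> (X j)) 1"
    and a: "\<And>j k. a j k = 1 / 2 * \<rho> (star (\<delta>X j) (\<delta>X k) + star (\<delta>X k) (\<delta>X j))"
  shows "(det (\<chi> j k. a j k) = 0 \<longleftrightarrow>
      (\<exists>x :: 'n \<Rightarrow> real hahn.
        (\<Sum>j\<in>UNIV. \<bar>x j\<bar>) > 0 \<and>
        \<rho> (star (\<Sum>j\<in>UNIV. series_scale (cplx (x j)) (\<delta>X j))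
                (\<Sum>k\<in>UNIV. series_scale (cplx (x k)) (\<delta>X k))) = 0)) \<and>
    (\<forall>x :: 'n \<Rightarrow> real hahn.
      \<rho> (star (\<Sum>j\<in>UNIV. series_scale (cplx (x j)) (\<delta>X j))
              (\<Sum>k\<in>UNIV. series_scale (cplx (x k)) (\<delta>X k))) = 0 \<longleftrightarrow>
      (\<Sum>j\<in>UNIV. series_scale (cplx (x j)) (\<delta>X j)) \<in> gelfand_ideal A star \<rho>)"
proof -
  interpret star_state A \<omega> star \<rho>
    using assms(1-3) by unfold_locales (auto simp: symplectic_manifold_def)
  have smooth_\<delta>X: "\<delta>X j \<in> smooth_series A" for j
    using assms(4) by (simp add: \<delta>X smooth_diff smooth_scale smooth_one)
  have cnj_\<delta>X: "series_cnj (\<delta>X j) = \<delta>X j" for j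
    using assms(4,5)
    by (simp add: \<delta>X series_cnj_diff series_cnj_scale series_cnj_one rho_self_conjugate)
  define m where "m j k = \<rho> (star (\<delta>X j) (\<delta>X k))" for j k
  have m_cnj: "hcnj (m j k) = m k j" for j k
    unfolding m_def by (rule rho_hermitian) (simp_all add: smooth_\<delta>X cnj_\<delta>X)
  \<comment> \<open>Conjugate symmetry of \<open>m\<close> turns the symmetrized covariances into real parts.\<close>
  define B :: "real hahn^'n^'n" where "B = (\<chi> j k. hahn_map Re (m j k))"
  have mB: "m j k + m k j = 2 * cplx (B $ j $ k)" for j k
    using add_hcnj[of "m j k"] by (simp add: B_def m_cnj)
  have aB: "a j k = cplx (B $ j $ k)" for j k
    using mB[of j k] two_complex_hahn
    by (simp add: a rho_add smooth_star smooth_\<delta>X flip: m_def)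
  have sym: "transpose B = B"
  proof -
    have "2 * cplx (B $ j $ k) = 2 * cplx (B $ k $ j)" for j k
      using mB[of j k] mB[of k j] by (simp add: add.commute)
    then have "B $ j $ k = B $ k $ j" for j k
      using two_complex_hahn by (simp add: cplx_eq_iff)
    then show ?thesis by (simp add: transpose_def vec_eq_iff)
  qed
  define Y where "Y x = (\<Sum>j\<in>UNIV. series_scale (cplx (x j)) (\<delta>X j))" for x :: "'n \<Rightarrow> real hahn"
  have smooth_Y: "Y x \<in> smooth_series A" for x
    by (simp add: Y_def smooth_sum smooth_scale smooth_\<delta>X)
  have cnj_Y: "series_cnj (Y x) = Y x" for x
    by (simp add: Y_def series_cnj_sum series_cnj_scale hcnj_cplx cnj_\<delta>X)
  \<comment> \<open>Only the symmetric part of \<open>m\<close> survives in the quadratic form, as the \<open>x j\<close> commute with each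
    other; twice the sum is compared with its copy with \<open>j\<close> and \<open>k\<close> exchanged.\<close>
  have YY: "\<rho> (star (Y x) (Y x)) = cplx (scalar_product (vec_lambda x) (B *v vec_lambda x))" for x
  proof -
    let ?w = "\<lambda>j k. cplx (x j) * (cplx (x k) * m j k)"
    have expand: "\<rho> (star (Y x) (Y x)) = (\<Sum>j\<in>UNIV. \<Sum>k\<in>UNIV. ?w j k)"
      by (simp add: Y_def star_sum star_scale rho_sum rho_scale smooth_sum smooth_scale smooth_star
          smooth_\<delta>X sum_distrib_left m_def)
        (subst sum.swap, simp add: mult.left_commute)
    have swap: "(\<Sum>j\<in>UNIV. \<Sum>k\<in>UNIV. ?w j k) = (\<Sum>j\<in>UNIV. \<Sum>k\<in>UNIV. ?w k j)"
      by (rule sum.swap)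
    have "2 * \<rho> (star (Y x) (Y x)) = (\<Sum>j\<in>UNIV. \<Sum>k\<in>UNIV. ?w j k + ?w k j)"
      unfolding sum.distrib mult_2 expand by (rule arg_cong[OF swap])
    also have "\<dots> = (\<Sum>j\<in>UNIV. \<Sum>k\<in>UNIV. cplx (x j) * (cplx (x k) * (m j k + m k j)))"
      by (simp add: algebra_simps)
    also have "\<dots> = 2 * cplx (scalar_product (vec_lambda x) (B *v vec_lambda x))"
      unfolding mB scalar_product_matrix_vector
      by (simp add: cplx.map_sum cplx.map_mult sum_distrib_left mult.left_commute)
    finally show ?thesis using two_complex_hahn by simp
  qed
  have psd: "0 \<le> scalar_product v (B *v v)" for v
  proof -
    obtain r where "r \<ge> 0" "\<rho> (star (Y (($) v)) (Y (($) v))) = cplx r"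
      using rho_positive[OF smooth_Y] cnj_Y by metis
    then show ?thesis using YY[of "($) v"] by (simp add: cplx_eq_iff)
  qed
  have nonzero: "(\<Sum>j\<in>UNIV. \<bar>x j\<bar>) > 0 \<longleftrightarrow> vec_lambda x \<noteq> 0" for x :: "'n \<Rightarrow> real hahn"
  proof -
    have "(\<Sum>j\<in>UNIV. \<bar>x j\<bar>) > 0 \<longleftrightarrow> (\<Sum>j\<in>UNIV. \<bar>x j\<bar>) \<noteq> 0"
      by (simp add: order_less_le sum_nonneg)
    then show ?thesis by (simp add: sum_nonneg_eq_0_iff vec_eq_iff)
  qed
  have "det (\<chi> j k. a j k) = cplx (det B)"
    by (simp add: aB cplx.map_det)
  then have "det (\<chi> j k. a j k) = 0 \<longleftrightarrow> (\<exists>v. v \<noteq> 0 \<and> scalar_product v (B *v v) = 0)"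
    by (simp add: cplx_eq_0_iff psd_det_eq_0_iff[OF sym psd])
  also have "\<dots> \<longleftrightarrow> (\<exists>x. (\<Sum>j\<in>UNIV. \<bar>x j\<bar>) > 0 \<and> \<rho> (star (Y x) (Y x)) = 0)"
    unfolding nonzero YY cplx_eq_0_iff by (metis vec_lambda_eta)
  finally show ?thesis
    using smooth_Y cnj_Y by (simp add: gelfand_ideal_def flip: Y_def)
qed

end
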